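(* Let $A\in\mathbb{R}^{m\times n}$, let $B\in\mathbb{R}^{n\times n}$ be symmetric positive definite, and let $S$ be a random real matrix with $m$ rows and $q$ columns (where $q$ itself may be random). Let $Z=A^TS(S^TAB^{-1}A^TS)^{\dagger}S^TA$, let $d=\mathrm{Rank}(S^TA)$, and let $$\rho=1-\lambda_{\min}(B^{-1}\mathbf{E}[Z])=1-\lambda_{\min}(B^{-1/2}\mathbf{E}[Z]B^{-1/2}).$$ Then $$0\le 1-\frac{\mathbf{E}[d]}{n}\le\rho\le 1.$$
   Context: $M^\dagger$ denotes the Moore-Penrose pseudoinverse, $\lambda_{\min}$ the smallest eigenvalue, and $\mathbf{E}[\cdot]$ expectation over the random matrix $S$. The matrix $Z\in\mathbb{R}^{n\times n}$ is symmetric positive semidefinite, and $B^{-1}\mathbf{E}[Z]$ is similar to the symmetric matrix $B^{-1/2}\mathbf{E}[Z]B^{-1/2}$, so its eigenvalues are real. *)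

theory Defs
  imports "HOL-Probability.Probability"
    "Jordan_Normal_Form.Gauss_Jordan_Elimination"
    "Jordan_Normal_Form.Char_Poly"
    "Jordan_Normal_Form.DL_Rank"
begin

definition pos_def_mat :: "nat \<Rightarrow> real mat \<Rightarrow> bool" where
  "pos_def_mat n B \<longleftrightarrow> B \<in> carrier_mat n n \<and> transpose_mat B = B \<and>
     (\<forall>v \<in> carrier_vec n. v \<noteq> 0\<^sub>v n \<longrightarrow> 0 < scalar_prod v (B *\<^sub>v v))"

text \<open>For invertible matrices only; otherwise the value is unspecified.\<close>

definition inv_mat :: "real mat \<Rightarrow> real mat" where
  "inv_mat B = the (mat_inverse B)"

definition sqrt_mat :: "real mat \<Rightarrow> real mat" where
  "sqrt_mat B = (THE R. pos_def_mat (dim_row B) R \<and> R * R = B)"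

text \<open>The Moore--Penrose pseudoinverse, given by the four Penrose conditions.
  For a matrix with zero rows or columns it is the transposed empty matrix.\<close>

definition is_pinv :: "real mat \<Rightarrow> real mat \<Rightarrow> bool" where
  "is_pinv M X \<longleftrightarrow> X \<in> carrier_mat (dim_col M) (dim_row M) \<and>
     M * X * M = M \<and> X * M * X = X \<and>
     transpose_mat (M * X) = M * X \<and> transpose_mat (X * M) = X * M"

definition pinv :: "real mat \<Rightarrow> real mat" where
  "pinv M = (THE X. is_pinv M X)"

text \<open>Meant for square matrices of positive size all of whose complex eigenvalues are real.\<close>

definition lambda_min :: "real mat \<Rightarrow> real" where
  "lambda_min M = Min {k. eigenvalue M k}"

definition rank_mat :: "real mat \<Rightarrow> nat" where
  "rank_mat M = vec_space.rank (dim_row M) M"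

text \<open>A random matrix with \<open>m\<close> rows and a random number \<open>q\<close> of columns is a random element of
  the disjoint union of the spaces of real \<open>m \<times> k\<close> matrices, each with its Borel sets:
  \<open>q\<close> is measurable, and on each event \<open>q = k\<close> every entry is measurable.\<close>

definition random_mat :: "'w measure \<Rightarrow> nat \<Rightarrow> ('w \<Rightarrow> nat) \<Rightarrow> ('w \<Rightarrow> real mat) \<Rightarrow> bool" where
  "random_mat P m q S \<longleftrightarrow>
     (\<forall>w \<in> space P. S w \<in> carrier_mat m (q w)) \<and>
     q \<in> measurable P (count_space UNIV) \<and>
     (\<forall>k. \<forall>i < m. \<forall>j < k.
        (\<lambda>w. S w $$ (i, j)) \<in> borel_measurable (restrict_space P {w \<in> space P. q w = k}))"

definition expect_mat :: "'w measure \<Rightarrow> nat \<Rightarrow> nat \<Rightarrow> ('w \<Rightarrow> real mat) \<Rightarrow> real mat" where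
  "expect_mat P nr nc X = mat nr nc (\<lambda>(i, j). integral\<^sup>L P (\<lambda>w. X w $$ (i, j)))"

end

theory Submission
  imports Defs "Jordan_Normal_Form.Spectral_Radius" "Jordan_Normal_Form.Schur_Decomposition"
    "Jordan_Normal_Form.Jordan_Normal_Form_Uniqueness"
begin

text \<open>Let \<open>R = B\<^sup>1\<^sup>/\<^sup>2\<close>, \<open>C = R\<^sup>-\<^sup>1\<close>, \<open>Y = C A\<^sup>T S\<close> and let \<open>Q = Y (Y\<^sup>T Y)\<^sup>\<dagger> Y\<^sup>T\<close> be the orthogonal
  projection onto the range of \<open>Y\<close>. Then \<open>Z = R Q R\<close>, so \<open>B\<^sup>-\<^sup>1 E[Z]\<close> is similar to
  \<open>C E[Z] C = E[Q]\<close>. This matrix is symmetric and positive semidefinite, whence \<open>\<rho> \<le> 1\<close>; its trace is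
  \<open>E[tr Q] = E[rank Y] = E[d] \<le> n\<close>, and the smallest eigenvalue is at most the average
  \<open>E[d] / n\<close> of all of them. Since \<open>Q\<close> is a pointwise limit of polynomials in \<open>Y Y\<^sup>T\<close> and its
  entries are bounded by 1, all the expectations exist.\<close>

unbundle no inner_syntax and no vec_syntax

section \<open>The spectral theorem\<close>

text \<open>The number of columns of \<open>S\<close>, hence of \<open>Y\<close>, varies with the
  outcome, and the pseudoinverse is not a continuous function of its argument, so the measurability
  of \<open>Q\<close> is not immediate from its formula. Both difficulties disappear once
  \<open>Q\<close> is tied to G = \<open>Y * transpose_mat Y\<close>, a matrix of fixed size n. With
  c = 1 + tr G, which exceeds every eigenvalue of the positive semidefinite G, the powers of 1 - G/c
  converge to the projection onto the kernel of G, and \<open>Q\<close> is the complementary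
  projection. A second concern is meaning: \<open>sqrt_mat\<close> and \<open>pinv\<close> are
  definite descriptions and \<open>lambda_min\<close> is a \<open>Min\<close>, so each has its
  intended value only after existence and uniqueness, or finiteness and nonemptiness, are known. The
  spectral theorem is proved for this purpose: functions of a symmetric matrix, taken in an
  orthonormal eigenbasis, give the required existence results.\<close>

lemma assoc_mult_mat_dim:
  "dim_col A = dim_row B \<Longrightarrow> dim_col B = dim_row C \<Longrightarrow>
    A * B * C = A * (B * (C :: 'a :: semiring_0 mat))"
  by (rule assoc_mult_mat[of _ "dim_row A" "dim_col A" _ "dim_col B" _ "dim_col C"]) auto

text \<open>As in the associativity rule above, the side condition is an equation of dimensions
  instead of carrier membership, so that the simplifier can discharge it while normalising long
  products.\<close>

lemma transpose_mult_dim: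
  "dim_col A = dim_row B \<Longrightarrow>
    transpose_mat (A * B) = transpose_mat B * transpose_mat (A :: 'a :: comm_semiring_0 mat)"
  by (rule transpose_mult[of _ "dim_row A" "dim_col A" _ "dim_col B"]) auto

lemma scalar_prod_self_pos:
  assumes "v \<in> carrier_vec n" "v \<noteq> 0\<^sub>v n"
  shows "0 < v \<bullet> (v :: real vec)"
proof -
  obtain i where i: "i < n" "v $ i \<noteq> 0"
    using assms by (metis carrier_vecD eq_vecI index_zero_vec)
  have "0 < (\<Sum>i = 0..<n. v $ i * v $ i)"
    by (rule sum_pos2[of _ i]) (use i in \<open>auto simp: zero_less_mult_iff linorder_neq_iff\<close>)
  then show ?thesis using assms by (simp add: scalar_prod_def)
qed

lemma scalar_prod_self_nonneg: "0 \<le> v \<bullet> (v :: real vec)"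
  by (auto simp: scalar_prod_def intro: sum_nonneg)

lemma scalar_prod_self_zero:
  assumes "v \<in> carrier_vec n" "v \<bullet> v = (0 :: real)"
  shows "v = 0\<^sub>v n"
  using scalar_prod_self_pos[OF assms(1)] assms(2) by fastforce

lemma symmetric_scalar_prod:
  assumes "A \<in> carrier_mat n n" "transpose_mat A = A" "x \<in> carrier_vec n" "y \<in> carrier_vec n"
  shows "x \<bullet> (A *\<^sub>v y) = (A *\<^sub>v x) \<bullet> (y :: real vec)"
  using transpose_vec_mult_scalar[of A n n y x] assms by simp

text \<open>For a complex eigenvector \<open>x + i y\<close> with eigenvalue \<open>a + i b\<close>, symmetry gives
  \<open>b (|x|\<^sup>2 + |y|\<^sup>2) = 0\<close>.\<close>

lemma real_symmetric_has_eigenvector: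
  fixes A :: "real mat"
  assumes A: "A \<in> carrier_mat n n" and sym: "transpose_mat A = A" and n: "0 < n"
  obtains v k where "v \<in> carrier_vec n" "v \<noteq> 0\<^sub>v n" "A *\<^sub>v v = k \<cdot>\<^sub>v v"
proof -
  let ?Ac = "map_mat complex_of_real A"
  have Ac: "?Ac \<in> carrier_mat n n" using A by simp
  from spectrum_non_empty[OF Ac] n obtain \<mu> where "eigenvalue ?Ac \<mu>"
    by (auto simp: spectrum_def)
  then obtain z where z: "z \<in> carrier_vec n" "z \<noteq> 0\<^sub>v n" "?Ac *\<^sub>v z = \<mu> \<cdot>\<^sub>v z"
    using A by (auto simp: eigenvalue_def eigenvector_def)
  define x where "x = map_vec Re z"
  define y where "y = map_vec Im z"
  define a where "a = Re \<mu>"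
  define b where "b = Im \<mu>"
  have x: "x \<in> carrier_vec n" and y: "y \<in> carrier_vec n" using z by (auto simp: x_def y_def)
  have dims: "dim_row A = n" "dim_col A = n" "dim_vec z = n" using A z by auto
  have comp: "(\<Sum>j = 0..<n. complex_of_real (A $$ (i, j)) * z $ j) = \<mu> * z $ i" if "i < n" for i
    using arg_cong[OF z(3), of "\<lambda>v. v $ i"] that dims
    by (simp add: scalar_prod_def)
  have Ax: "A *\<^sub>v x = a \<cdot>\<^sub>v x - b \<cdot>\<^sub>v y"
  proof (rule eq_vecI)
    fix i assume "i < dim_vec (a \<cdot>\<^sub>v x - b \<cdot>\<^sub>v y)"
    then have i: "i < n" using y by simp
    show "(A *\<^sub>v x) $ i = (a \<cdot>\<^sub>v x - b \<cdot>\<^sub>v y) $ i"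
      using arg_cong[OF comp[OF i], of Re] i dims
      by (simp add: scalar_prod_def x_def y_def a_def b_def)
  qed (use dims y in simp)
  have Ay: "A *\<^sub>v y = a \<cdot>\<^sub>v y + b \<cdot>\<^sub>v x"
  proof (rule eq_vecI)
    fix i assume "i < dim_vec (a \<cdot>\<^sub>v y + b \<cdot>\<^sub>v x)"
    then have i: "i < n" using x by simp
    show "(A *\<^sub>v y) $ i = (a \<cdot>\<^sub>v y + b \<cdot>\<^sub>v x) $ i"
      using arg_cong[OF comp[OF i], of Im] i dims
      by (simp add: scalar_prod_def x_def y_def a_def b_def)
  qed (use dims x in simp)
  have "x \<bullet> (A *\<^sub>v y) = a * (x \<bullet> y) + b * (x \<bullet> x)"
    unfolding Ay using x y by (simp add: scalar_prod_add_distrib[of _ n])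
  moreover have "(A *\<^sub>v x) \<bullet> y = a * (x \<bullet> y) - b * (y \<bullet> y)"
    unfolding Ax using x y by (simp add: minus_scalar_prod_distrib[of _ n])
  ultimately have eq: "b * (x \<bullet> x) + b * (y \<bullet> y) = 0"
    using symmetric_scalar_prod[OF A sym x y] by simp
  have xy: "x \<noteq> 0\<^sub>v n \<or> y \<noteq> 0\<^sub>v n"
  proof (rule ccontr)
    assume "\<not> ?thesis"
    then have 0: "x = 0\<^sub>v n" "y = 0\<^sub>v n" by auto
    have "z = 0\<^sub>v n"
    proof (rule eq_vecI)
      fix i assume "i < dim_vec (0\<^sub>v n :: complex vec)"
      then have i: "i < n" by simp
      show "z $ i = 0\<^sub>v n $ i"
        using arg_cong[OF 0(1), of "\<lambda>v. v $ i"] arg_cong[OF 0(2), of "\<lambda>v. v $ i"] i dims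
        by (simp add: x_def y_def complex_eq_iff)
    qed (use dims in simp)
    with z show False by simp
  qed
  have "b = 0"
  proof -
    have "0 < x \<bullet> x + y \<bullet> y"
      using xy scalar_prod_self_pos[OF x] scalar_prod_self_pos[OF y]
        scalar_prod_self_nonneg[of x] scalar_prod_self_nonneg[of y] by fastforce
    then show ?thesis using eq by (metis distrib_left mult_eq_0_iff less_irrefl)
  qed
  then have "A *\<^sub>v x = a \<cdot>\<^sub>v x" "A *\<^sub>v y = a \<cdot>\<^sub>v y"
    unfolding Ax Ay using x y by (auto intro!: eq_vecI)
  then show thesis using that x y xy by blast
qed

text \<open>Complete \<open>v\<close> to a basis and orthogonalise: Gram-Schmidt keeps the head of
  the list, so after normalisation column 0 is still a multiple of \<open>v\<close>. Proportionality
  suffices to carry an eigenvector equation over to that column.\<close>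

lemma orthogonal_mat_with_first_column:
  fixes v :: "real vec"
  assumes v: "v \<in> carrier_vec n" and v0: "v \<noteq> 0\<^sub>v n"
  obtains U c where "U \<in> carrier_mat n n" "transpose_mat U * U = 1\<^sub>m n" "col U 0 = c \<cdot>\<^sub>v v"
proof -
  interpret cof_vec_space n "TYPE(real)" .
  define b where "b = basis_completion v"
  note bc = basis_completion[OF v v0, folded b_def]
  have n: "0 < n" using v v0 by (cases n) auto
  obtain vs where bv: "b = v # vs" using bc(6,7) n by (cases b) auto
  define ws where "ws = gram_schmidt n b"
  note gs = gram_schmidt_result[OF bc(2,4,5) ws_def]
  have hd: "ws ! 0 = v" using gram_schmidt_hd[OF v, of vs] gs(4) bc(6) n
    by (simp add: ws_def bv hd_conv_nth length_greater_0_conv[symmetric] del: length_greater_0_conv)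
  have ws: "ws ! i \<in> carrier_vec n" if "i < n" for i
    using gs(3,4) bc(6) that by (metis nth_mem subset_iff)
  have orth: "(ws ! i \<bullet> ws ! j = 0) = (i \<noteq> j)" if "i < n" "j < n" for i j
    using corthogonalD[OF gs(2), of i j] that gs(4) bc(6)
    by (simp add: conjugate_vec_def vec_eq_iff) 
  define s where "s i = sqrt (ws ! i \<bullet> ws ! i)" for i
  have s: "s i \<noteq> 0" "s i * s i = ws ! i \<bullet> ws ! i" if "i < n" for i
    using orth[OF that that] scalar_prod_self_nonneg[of "ws ! i"]
    by (auto simp: s_def)
  define U where "U = mat n n (\<lambda>(i, j). (ws ! j $ i) / s j)"
  have U: "U \<in> carrier_mat n n" by (simp add: U_def)
  have "transpose_mat U * U = 1\<^sub>m n"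
  proof (rule eq_matI)
    fix i j assume "i < dim_row (1\<^sub>m n :: real mat)" "j < dim_col (1\<^sub>m n :: real mat)"
    then have i: "i < n" and j: "j < n" by auto
    have "(transpose_mat U * U) $$ (i, j) = (\<Sum>k = 0..<n. (ws ! i $ k / s i) * (ws ! j $ k / s j))"
      using i j by (simp add: scalar_prod_def U_def)
    also have "\<dots> = (ws ! i \<bullet> ws ! j) / (s i * s j)"
      using ws[OF j] by (simp add: scalar_prod_def sum_divide_distrib)
    also have "\<dots> = 1\<^sub>m n $$ (i, j)"
      using orth[OF i j] s[OF i] i j by auto
    finally show "(transpose_mat U * U) $$ (i, j) = 1\<^sub>m n $$ (i, j)" .
  qed (auto simp: U_def)
  moreover have "col U 0 = (1 / s 0) \<cdot>\<^sub>v v"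
    using n v by (auto simp: U_def hd intro!: eq_vecI)
  ultimately show thesis using that U by blast
qed

text \<open>Deflation by induction on the size: in an orthonormal basis that starts with an
  eigenvector, the matrix splits into the eigenvalue and a smaller symmetric block.\<close>

lemma real_symmetric_spectral:
  fixes A :: "real mat"
  assumes "A \<in> carrier_mat n n" "transpose_mat A = A"
  obtains U t where "U \<in> carrier_mat n n" "transpose_mat U * U = 1\<^sub>m n" "U * transpose_mat U = 1\<^sub>m n"
    "A = U * mat_diag n t * transpose_mat U"
proof -
  have "\<exists>U t. U \<in> carrier_mat n n \<and> transpose_mat U * U = 1\<^sub>m n \<and> A = U * mat_diag n t * transpose_mat U"
    using assms
  proof (induction n arbitrary: A)
    case 0
    then show ?case by (intro exI[of _ "1\<^sub>m 0"] exI[of _ "\<lambda>_. 0"]) (auto intro!: eq_matI)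
  next
    case (Suc n)
    let ?N = "Suc n"
    note A = Suc.prems(1) and sym = Suc.prems(2)
    obtain v k where v: "v \<in> carrier_vec ?N" "v \<noteq> 0\<^sub>v ?N" "A *\<^sub>v v = k \<cdot>\<^sub>v v"
      using real_symmetric_has_eigenvector[OF A sym] by blast
    obtain U0 c where U0: "U0 \<in> carrier_mat ?N ?N" and UU: "transpose_mat U0 * U0 = 1\<^sub>m ?N"
      and col: "col U0 0 = c \<cdot>\<^sub>v v"
      using orthogonal_mat_with_first_column[OF v(1,2)] by blast
    have UU': "U0 * transpose_mat U0 = 1\<^sub>m ?N"
      using mat_mult_left_right_inverse[of "transpose_mat U0" ?N U0] U0 UU by simp
    define A' where "A' = transpose_mat U0 * A * U0"
    have A': "A' \<in> carrier_mat ?N ?N" using A U0 by (simp add: A'_def)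
    have dims [simp]: "dim_row A = ?N" "dim_col A = ?N" "dim_row U0 = ?N" "dim_col U0 = ?N"
      using A U0 by auto
    have sym': "transpose_mat A' = A'"
      by (simp add: A'_def transpose_mult_dim assoc_mult_mat_dim sym)
    have Acol: "A *\<^sub>v col U0 0 = k \<cdot>\<^sub>v col U0 0"
      unfolding col using v mult_mat_vec[OF A v(1)] by (simp add: smult_smult_assoc mult.commute)
    have c0: "A' $$ (i, 0) = (if i = 0 then k else 0)" if i: "i < ?N" for i
    proof -
      have "A' $$ (i, 0) = col (transpose_mat U0 * (A * U0)) 0 $ i"
        using i A' by (simp add: A'_def assoc_mult_mat_dim)
      also have "col (transpose_mat U0 * (A * U0)) 0 = transpose_mat U0 *\<^sub>v (A *\<^sub>v col U0 0)"
        using A U0 by (simp add: col_mult2[of _ ?N ?N _ ?N] mult_mat_vec_def)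
      also have "\<dots> = k \<cdot>\<^sub>v (transpose_mat U0 *\<^sub>v col U0 0)"
        unfolding Acol using U0 by (intro mult_mat_vec[of _ ?N ?N]) (auto intro!: carrier_vecI)
      also have "transpose_mat U0 *\<^sub>v col U0 0 = col (1\<^sub>m ?N) 0"
        unfolding UU[symmetric] using U0 by (simp add: col_mult2[of _ ?N ?N _ ?N] mult_mat_vec_def)
      finally show ?thesis using i by simp
    qed
    \<comment> \<open>Symmetry transfers the zeros of the first column to the first row, which makes
      \<open>A'\<close> block diagonal.\<close>
    have r0: "A' $$ (0, i) = (if i = 0 then k else 0)" if i: "i < ?N" for i
      using c0[OF i] arg_cong[OF sym', of "\<lambda>M. M $$ (i, 0)"] A' i by simp
    define A3 where "A3 = mat n n (\<lambda>(i, j). A' $$ (Suc i, Suc j))"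
    have A3: "A3 \<in> carrier_mat n n" by (simp add: A3_def)
    have "transpose_mat A3 = A3"
    proof (rule eq_matI)
      fix i j assume "i < dim_row A3" "j < dim_col A3"
      then have "i < n" "j < n" by (auto simp: A3_def)
      then show "transpose_mat A3 $$ (i, j) = A3 $$ (i, j)"
        using arg_cong[OF sym', of "\<lambda>M. M $$ (Suc i, Suc j)"] A' by (simp add: A3_def)
    qed (auto simp: A3_def)
    then obtain U3 t where U3: "U3 \<in> carrier_mat n n" "transpose_mat U3 * U3 = 1\<^sub>m n"
      and A3eq: "A3 = U3 * mat_diag n t * transpose_mat U3"
      using Suc.IH[OF A3] by blast
    \<comment> \<open>\<open>F\<close> lets the smaller eigenbasis act on the coordinates after the
      first; accordingly \<open>t'\<close> puts \<open>k\<close> in position 0 and shifts the other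
      eigenvalues by one.\<close>
    define F where "F = four_block_mat (1\<^sub>m 1) (0\<^sub>m 1 n) (0\<^sub>m n 1) U3"
    define t' where "t' = case_nat k t"
    have F: "F \<in> carrier_mat ?N ?N" using U3 unfolding F_def carrier_mat_def by auto
    have FT: "transpose_mat F = four_block_mat (1\<^sub>m 1) (0\<^sub>m 1 n) (0\<^sub>m n 1) (transpose_mat U3)"
      unfolding F_def using U3 by (subst transpose_four_block_mat[of _ 1 1 _ n _ n]) auto
    have D: "mat_diag ?N t' = four_block_mat (mat 1 1 (\<lambda>_. k)) (0\<^sub>m 1 n) (0\<^sub>m n 1) (mat_diag n t)"
      by (rule eq_matI) (auto simp: mat_diag_def t'_def four_block_mat_def Let_def split: nat.split)
    have A'blk: "A' = four_block_mat (mat 1 1 (\<lambda>_. k)) (0\<^sub>m 1 n) (0\<^sub>m n 1) A3"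
      using A' by (intro eq_matI) (auto simp: four_block_mat_def Let_def A3_def c0 r0)
    have FF: "transpose_mat F * F = 1\<^sub>m ?N"
      unfolding FT unfolding F_def using U3
      by (subst mult_four_block_mat[of _ 1 1 _ n _ n _ _ 1 _ n])
         (auto intro!: eq_matI simp: four_block_mat_def Let_def)
    have z [simp]: "0\<^sub>m k n * mat_diag n t = 0\<^sub>m k n" "0\<^sub>m k n * transpose_mat U3 = 0\<^sub>m k n"
      "U3 * mat_diag n t * 0\<^sub>m n k = 0\<^sub>m n k" "U3 * 0\<^sub>m n k = 0\<^sub>m n k" for k
      using U3 by (simp_all add: left_mult_zero_mat[of _ n n] right_mult_zero_mat[of _ n n])
    have "F * mat_diag ?N t' = four_block_mat (mat 1 1 (\<lambda>_. k)) (0\<^sub>m 1 n) (0\<^sub>m n 1) (U3 * mat_diag n t)"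
      unfolding F_def D using U3
      by (subst mult_four_block_mat[of _ 1 1 _ n _ n _ _ 1 _ n]) (simp_all add: left_add_zero_mat[of _ n n])
    moreover have "\<dots> * transpose_mat F = A'"
      unfolding FT A'blk using U3 A3
      by (subst mult_four_block_mat[of _ 1 1 _ n _ n _ _ 1 _ n])
         (simp_all add: left_add_zero_mat[of _ n n] A3eq[symmetric])
    ultimately have "F * mat_diag ?N t' * transpose_mat F = A'" by simp
    then have A'F: "A' = F * (mat_diag ?N t' * transpose_mat F)"
      using F by (simp add: assoc_mult_mat[of _ ?N ?N _ ?N _ ?N])
    have "A = (U0 * transpose_mat U0) * A * (U0 * transpose_mat U0)"
      unfolding UU' using A by simp
    also have "\<dots> = U0 * A' * transpose_mat U0"
      by (simp add: A'_def assoc_mult_mat_dim)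
    finally have "A = (U0 * F) * mat_diag ?N t' * transpose_mat (U0 * F)"
      unfolding A'F using F by (simp add: assoc_mult_mat_dim transpose_mult_dim mat_diag_def)
    moreover have "transpose_mat (U0 * F) * (U0 * F) = transpose_mat F * (transpose_mat U0 * U0) * F"
      using F by (simp add: assoc_mult_mat_dim transpose_mult_dim)
    ultimately show ?case using F U0 FF UU by (intro exI[of _ "U0 * F"] exI[of _ t']) auto
  qed
  then obtain U t where "U \<in> carrier_mat n n" "transpose_mat U * U = 1\<^sub>m n"
    "A = U * mat_diag n t * transpose_mat U" by blast
  moreover have "U * transpose_mat U = 1\<^sub>m n"
    using mat_mult_left_right_inverse[of "transpose_mat U" n U] calculation by simp
  ultimately show thesis using that by blast
qed

section \<open>Trace and functions of a symmetric matrix in an eigenbasis\<close>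

definition mat_trace :: "real mat \<Rightarrow> real" where
  "mat_trace M = (\<Sum>i<dim_row M. M $$ (i, i))"

lemma mat_trace_mult_commute:
  assumes "A \<in> carrier_mat n k" "B \<in> carrier_mat k n"
  shows "mat_trace (A * B) = mat_trace (B * A)"
proof -
  have "mat_trace (A * B) = (\<Sum>i<n. \<Sum>j<k. A $$ (i, j) * B $$ (j, i))"
    using assms by (simp add: mat_trace_def scalar_prod_def atLeast0LessThan)
  also have "\<dots> = (\<Sum>j<k. \<Sum>i<n. B $$ (j, i) * A $$ (i, j))"
    by (subst sum.swap) (simp add: mult.commute)
  also have "\<dots> = mat_trace (B * A)"
    using assms by (simp add: mat_trace_def scalar_prod_def atLeast0LessThan)
  finally show ?thesis .
qed

lemma mat_diag_dims [simp]: "dim_row (mat_diag n f) = n" "dim_col (mat_diag n f) = n"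
  by (simp_all add: mat_diag_def)

lemma transpose_mat_diag [simp]: "transpose_mat (mat_diag n f) = mat_diag n f"
  by (auto simp: mat_diag_def intro!: eq_matI)

locale orthogonal_matrix =
  fixes n :: nat and U :: "real mat"
  assumes U: "U \<in> carrier_mat n n"
    and UTU: "transpose_mat U * U = 1\<^sub>m n"
    and UUT: "U * transpose_mat U = 1\<^sub>m n"
begin

lemma dims [simp]: "dim_row U = n" "dim_col U = n"
  using U by auto

text \<open>A functional calculus: if \<open>A = conj_diag t\<close>, then
  \<open>conj_diag (\<lambda>i. g (t i))\<close> is g applied to \<open>A\<close>. Inverses, square
  roots, pseudoinverses and powers below are all obtained in this form.\<close>

definition conj_diag :: "(nat \<Rightarrow> real) \<Rightarrow> real mat" where
  "conj_diag f = U * mat_diag n f * transpose_mat U"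

lemma conj_diag_carrier [simp]: "conj_diag f \<in> carrier_mat n n"
  by (intro carrier_matI) (simp_all add: conj_diag_def)

lemma conj_diag_dims [simp]: "dim_row (conj_diag f) = n" "dim_col (conj_diag f) = n"
  using conj_diag_carrier[of f] by (auto simp del: conj_diag_carrier)

lemma conj_diag_symmetric [simp]: "transpose_mat (conj_diag f) = conj_diag f"
  by (simp add: conj_diag_def transpose_mult_dim assoc_mult_mat_dim)

lemma conj_diag_mult [simp]: "conj_diag f * conj_diag g = conj_diag (\<lambda>i. f i * g i)"
proof -
  have "conj_diag f * conj_diag g = U * mat_diag n f * (transpose_mat U * U) * (mat_diag n g * transpose_mat U)"
    by (simp add: conj_diag_def assoc_mult_mat_dim)
  also have "\<dots> = U * (mat_diag n f * mat_diag n g) * transpose_mat U"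
    unfolding UTU by (simp add: assoc_mult_mat_dim right_mult_one_mat[of _ n n] del: mat_diag_diag)
  finally show ?thesis by (simp add: conj_diag_def)
qed

lemma conj_diag_one: "conj_diag (\<lambda>_. 1) = 1\<^sub>m n"
  using U by (simp add: conj_diag_def UUT)

lemma conj_diag_cong: "(\<And>i. i < n \<Longrightarrow> f i = g i) \<Longrightarrow> conj_diag f = conj_diag g"
  unfolding conj_diag_def by (intro arg_cong[of _ _ "\<lambda>D. U * D * transpose_mat U"] eq_matI) (auto simp: mat_diag_def)

lemma conj_diag_entry:
  assumes "i < n" "j < n"
  shows "conj_diag f $$ (i, j) = (\<Sum>k<n. U $$ (i, k) * f k * U $$ (j, k))"
  using assms U unfolding conj_diag_def
  by (subst mat_diag_mult_right[of _ n]) (auto simp: scalar_prod_def atLeast0LessThan intro!: sum.cong)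

lemma trace_conj_diag: "mat_trace (conj_diag f) = (\<Sum>i<n. f i)"
proof -
  have "mat_trace (conj_diag f) = mat_trace (U * (mat_diag n f * transpose_mat U))"
    by (simp add: conj_diag_def assoc_mult_mat_dim)
  also have "\<dots> = mat_trace (mat_diag n f * (transpose_mat U * U))"
    using U by (subst mat_trace_mult_commute[of _ n n]) (auto simp: assoc_mult_mat_dim)
  finally show ?thesis unfolding UTU by (simp add: right_mult_one_mat[of _ n n]) (simp add: mat_trace_def mat_diag_def)
qed

lemma similar_conj_diag: "similar_mat_wit (conj_diag f) (mat_diag n f) U (transpose_mat U)"
  by (rule similar_mat_witI[OF UUT UTU conj_diag_def conj_diag_carrier mat_diag_dim U]) (use U in simp)

text \<open>Similarity preserves the characteristic polynomial, and that of a diagonal matrix is the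
  product of its linear factors.\<close>

lemma eigenvalue_conj_diag: "eigenvalue (conj_diag f) k \<longleftrightarrow> k \<in> f ` {..<n}"
proof -
  have "char_poly (conj_diag f) = char_poly (mat_diag n f)"
    using similar_conj_diag by (intro char_poly_similar) (auto simp: similar_mat_def)
  also have "\<dots> = (\<Prod>a\<leftarrow>diag_mat (mat_diag n f). [:- a, 1:])"
    by (rule char_poly_upper_triangular[of _ n]) (auto simp: mat_diag_def)
  finally have "poly (char_poly (conj_diag f)) k = 0 \<longleftrightarrow> k \<in> set (diag_mat (mat_diag n f))"
    by (auto simp: poly_prod_list prod_list_zero_iff)
  then show ?thesis
    by (auto simp: eigenvalue_root_char_poly[OF conj_diag_carrier] diag_mat_def mat_diag_def)
qed

end

lemma symmetric_spectral:
  fixes A :: "real mat"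
  assumes "A \<in> carrier_mat n n" "transpose_mat A = A"
  obtains U t where "orthogonal_matrix n U" "A = orthogonal_matrix.conj_diag n U t"
proof -
  obtain U t where spectral: "U \<in> carrier_mat n n" "transpose_mat U * U = 1\<^sub>m n" "U * transpose_mat U = 1\<^sub>m n"
    "A = U * mat_diag n t * transpose_mat U"
    using real_symmetric_spectral[OF assms] .
  interpret orthogonal_matrix n U using spectral by unfold_locales
  show thesis using that orthogonal_matrix_axioms spectral(4) by (simp add: conj_diag_def)
qed

lemma eigenvalue_vector:
  assumes "M \<in> carrier_mat n n" "eigenvalue M k"
  obtains v where "v \<in> carrier_vec n" "v \<noteq> 0\<^sub>v n" "M *\<^sub>v v = k \<cdot>\<^sub>v v"
  using assms by (auto simp: eigenvalue_def eigenvector_def)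

text \<open>The spectral theorem exhibits the set under \<open>Min\<close> as a finite image,
  nonempty because \<open>0 < n\<close>, so the minimum is attained. The trace sums the n
  eigenvalues with multiplicity, each at least the minimum.\<close>

lemma lambda_min_symmetric:
  assumes "M \<in> carrier_mat n n" "transpose_mat M = M" "0 < n"
  shows "eigenvalue M (lambda_min M)" "real n * lambda_min M \<le> mat_trace M"
proof -
  obtain U t where "orthogonal_matrix n U" and M: "M = orthogonal_matrix.conj_diag n U t"
    using symmetric_spectral[OF assms(1,2)] .
  interpret orthogonal_matrix n U by fact
  have ev: "{k. eigenvalue M k} = t ` {..<n}" by (auto simp: M eigenvalue_conj_diag)
  have "lambda_min M \<in> {k. eigenvalue M k}"
    unfolding lambda_min_def ev using \<open>0 < n\<close> by (intro Min_in) auto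
  then show "eigenvalue M (lambda_min M)" by simp
  have "lambda_min M \<le> t i" if "i < n" for i
    unfolding lambda_min_def ev using that by (intro Min_le) auto
  then have "(\<Sum>i<n. lambda_min M) \<le> (\<Sum>i<n. t i)" by (intro sum_mono) auto
  then show "real n * lambda_min M \<le> mat_trace M" by (simp add: M trace_conj_diag)
qed

lemma lambda_min_nonneg:
  assumes M: "M \<in> carrier_mat n n" "transpose_mat M = M" "0 < n"
    and psd: "\<And>v. v \<in> carrier_vec n \<Longrightarrow> 0 \<le> v \<bullet> (M *\<^sub>v v)"
  shows "0 \<le> lambda_min M"
proof -
  obtain v where v: "v \<in> carrier_vec n" "v \<noteq> 0\<^sub>v n" "M *\<^sub>v v = lambda_min M \<cdot>\<^sub>v v"
    using eigenvalue_vector[OF M(1) lambda_min_symmetric(1)[OF M]] .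
  have "0 \<le> lambda_min M * (v \<bullet> v)" using psd[OF v(1)] v by simp
  with scalar_prod_self_pos[OF v(1,2)] show ?thesis by (simp add: zero_le_mult_iff)
qed

text \<open>Serves the uniqueness of square roots, where it is applied to the difference of two
  candidates.\<close>

lemma symmetric_zero_eigenvalues:
  fixes D :: "real mat"
  assumes D: "D \<in> carrier_mat n n" "transpose_mat D = D" and ev: "\<And>k. eigenvalue D k \<Longrightarrow> k = 0"
  shows "D = 0\<^sub>m n n"
proof -
  obtain U t where "orthogonal_matrix n U" and M: "D = orthogonal_matrix.conj_diag n U t"
    using symmetric_spectral[OF D] .
  interpret orthogonal_matrix n U by fact
  have "D = conj_diag (\<lambda>_. 0)" unfolding M using ev by (intro conj_diag_cong) (auto simp: M eigenvalue_conj_diag)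
  also have "\<dots> = 0\<^sub>m n n" by (rule eq_matI) (auto simp: conj_diag_entry)
  finally show ?thesis .
qed

section \<open>Positive definite matrices\<close>

lemma pos_def_matD:
  assumes "pos_def_mat n B"
  shows "B \<in> carrier_mat n n" "transpose_mat B = B"
    "\<And>v. v \<in> carrier_vec n \<Longrightarrow> v \<noteq> 0\<^sub>v n \<Longrightarrow> 0 < v \<bullet> (B *\<^sub>v v)"
  using assms by (auto simp: pos_def_mat_def)

lemma pos_def_eigenvalue_pos:
  assumes "pos_def_mat n B" "eigenvalue B k"
  shows "0 < k"
proof -
  note B = pos_def_matD[OF assms(1)]
  obtain v where v: "v \<in> carrier_vec n" "v \<noteq> 0\<^sub>v n" "B *\<^sub>v v = k \<cdot>\<^sub>v v"
    using eigenvalue_vector[OF B(1) assms(2)] .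
  have "0 < k * (v \<bullet> v)" using B(3)[OF v(1,2)] v by simp
  with scalar_prod_self_pos[OF v(1,2)] show ?thesis by (simp add: zero_less_mult_iff)
qed

text \<open>Two-sided inverses are unique, so exhibiting one determines what
  \<open>mat_inverse\<close> returns.\<close>

lemma inv_mat_eqI:
  assumes "B \<in> carrier_mat n n" "X \<in> carrier_mat n n" "B * X = 1\<^sub>m n" "X * B = 1\<^sub>m n"
  shows "inv_mat B = X"
proof -
  have "B \<in> Units (ring_mat TYPE(real) n ())"
    using assms by (auto simp: Units_def ring_mat_def)
  then obtain Y where Y: "mat_inverse B = Some Y"
    using mat_inverse(1)[OF assms(1), of "()"] by (cases "mat_inverse B") auto
  note Y' = mat_inverse(2)[OF assms(1) Y]
  have "Y = Y * (B * X)" using Y' assms by auto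
  also have "\<dots> = (Y * B) * X" using Y' assms by (intro assoc_mult_mat[symmetric]) auto
  also have "\<dots> = X" using Y' assms by auto
  finally show ?thesis by (simp add: inv_mat_def Y)
qed

lemma inv_mat_pos_def:
  assumes "pos_def_mat n B"
  shows "inv_mat B \<in> carrier_mat n n" "B * inv_mat B = 1\<^sub>m n" "inv_mat B * B = 1\<^sub>m n"
    "transpose_mat (inv_mat B) = inv_mat B"
proof -
  note B = pos_def_matD[OF assms]
  obtain U t where "orthogonal_matrix n U" and Bt: "B = orthogonal_matrix.conj_diag n U t"
    using symmetric_spectral[OF B(1,2)] .
  interpret orthogonal_matrix n U by fact
  have t: "t i \<noteq> 0" if "i < n" for i
    using pos_def_eigenvalue_pos[OF assms, of "t i"] that by (auto simp: Bt eigenvalue_conj_diag)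
  have 1: "B * conj_diag (\<lambda>i. inverse (t i)) = 1\<^sub>m n" "conj_diag (\<lambda>i. inverse (t i)) * B = 1\<^sub>m n"
    unfolding Bt conj_diag_one[symmetric] using t by (auto intro!: conj_diag_cong)
  have "inv_mat B = conj_diag (\<lambda>i. inverse (t i))"
    by (rule inv_mat_eqI[OF B(1) _ 1]) simp
  with 1 show "inv_mat B \<in> carrier_mat n n" "B * inv_mat B = 1\<^sub>m n" "inv_mat B * B = 1\<^sub>m n"
    "transpose_mat (inv_mat B) = inv_mat B" by auto
qed

lemma pos_def_mat_sqrt_exists:
  assumes "pos_def_mat n B"
  shows "\<exists>R. pos_def_mat n R \<and> R * R = B"
proof -
  note B = pos_def_matD[OF assms]
  obtain U t where "orthogonal_matrix n U" and Bt: "B = orthogonal_matrix.conj_diag n U t"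
    using symmetric_spectral[OF B(1,2)] .
  interpret orthogonal_matrix n U by fact
  have t: "0 < t i" if "i < n" for i
    using pos_def_eigenvalue_pos[OF assms, of "t i"] that by (auto simp: Bt eigenvalue_conj_diag)
  define R where "R = conj_diag (\<lambda>i. sqrt (t i))"
  \<comment> \<open>A fourth root of \<open>B\<close>: since \<open>Q * Q = R\<close>, the quadratic
    form of \<open>R\<close> at \<open>v\<close> is the squared norm of
    \<open>Q *\<^sub>v v\<close>, whence positivity.\<close>
  define Q where "Q = conj_diag (\<lambda>i. sqrt (sqrt (t i)))"
  have QQ: "Q * Q = R" unfolding Q_def R_def conj_diag_mult
    by (rule conj_diag_cong) (use t in \<open>simp add: less_imp_le\<close>)
  have RR: "R * R = B" unfolding Bt R_def conj_diag_mult
    by (rule conj_diag_cong) (use t in \<open>simp add: less_imp_le\<close>)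
  have Q: "Q \<in> carrier_mat n n" "transpose_mat Q = Q" by (auto simp: Q_def)
  have R: "R \<in> carrier_mat n n" "transpose_mat R = R" by (auto simp: R_def)
  have "0 < v \<bullet> (R *\<^sub>v v)" if v: "v \<in> carrier_vec n" "v \<noteq> 0\<^sub>v n" for v
  proof -
    have "R *\<^sub>v v = Q *\<^sub>v (Q *\<^sub>v v)" unfolding QQ[symmetric] using Q v by simp
    then have "v \<bullet> (R *\<^sub>v v) = (Q *\<^sub>v v) \<bullet> (Q *\<^sub>v v)"
      using symmetric_scalar_prod[OF Q v(1), of "Q *\<^sub>v v"] Q v by simp
    moreover have "Q *\<^sub>v v \<noteq> 0\<^sub>v n"
    proof
      assume "Q *\<^sub>v v = 0\<^sub>v n"
      then have "R *\<^sub>v v = 0\<^sub>v n" using \<open>R *\<^sub>v v = _\<close> Q by (auto intro!: eq_vecI)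
      moreover have "B *\<^sub>v v = R *\<^sub>v (R *\<^sub>v v)" unfolding RR[symmetric] using R v by simp
      ultimately have "B *\<^sub>v v = 0\<^sub>v n" using R by (auto intro!: eq_vecI)
      with B(3)[OF v] v show False by simp
    qed
    ultimately show ?thesis using scalar_prod_self_pos[of "Q *\<^sub>v v" n] Q v by simp
  qed
  then show ?thesis using R RR by (auto simp: pos_def_mat_def)
qed

text \<open>With \<open>D = R - Q\<close>, an eigenvector \<open>v\<close> of \<open>D\<close> for \<open>k\<close> satisfies
  \<open>0 = v \<bullet> (R D + D Q) v = k (v \<bullet> R v + v \<bullet> Q v)\<close>.\<close>

lemma pos_def_mat_sqrt_unique:
  assumes "pos_def_mat n R" "pos_def_mat n Q" "R * R = Q * Q"
  shows "R = Q"
proof -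
  note R = pos_def_matD[OF assms(1)] and Q = pos_def_matD[OF assms(2)]
  have D: "R - Q \<in> carrier_mat n n" using Q(1) by (rule minus_carrier_mat)
  have DT: "transpose_mat (R - Q) = R - Q" using R Q by (simp add: transpose_minus[of _ n n])
  have "R - Q = 0\<^sub>m n n"
  proof (rule symmetric_zero_eigenvalues[OF D DT])
    fix k assume "eigenvalue (R - Q) k"
    then obtain v where v: "v \<in> carrier_vec n" "v \<noteq> 0\<^sub>v n" "(R - Q) *\<^sub>v v = k \<cdot>\<^sub>v v"
      using eigenvalue_vector[OF D] by blast
    have Rv: "R *\<^sub>v v \<in> carrier_vec n" and Qv: "Q *\<^sub>v v \<in> carrier_vec n" using R Q v by auto
    have kv: "R *\<^sub>v v - Q *\<^sub>v v = k \<cdot>\<^sub>v v"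
      using v(3) minus_mult_distrib_mat_vec[OF R(1) Q(1) v(1)] by simp
    have RRv: "(R *\<^sub>v v) \<bullet> (R *\<^sub>v v) = v \<bullet> ((R * R) *\<^sub>v v)"
      using symmetric_scalar_prod[OF R(1,2) v(1) Rv] R v by simp
    have QQv: "(Q *\<^sub>v v) \<bullet> (Q *\<^sub>v v) = v \<bullet> ((Q * Q) *\<^sub>v v)"
      using symmetric_scalar_prod[OF Q(1,2) v(1) Qv] Q v by simp
    have "(R *\<^sub>v v) \<bullet> (R *\<^sub>v v) = (Q *\<^sub>v v) \<bullet> (Q *\<^sub>v v)"
      unfolding RRv QQv assms(3) ..
    \<comment> \<open>Difference of two equal squares; the mixed terms cancel because the real
      scalar product is commutative.\<close>
    then have "(R *\<^sub>v v - Q *\<^sub>v v) \<bullet> (R *\<^sub>v v + Q *\<^sub>v v) = 0"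
      using Rv Qv comm_scalar_prod[OF Rv Qv]
      by (simp add: minus_scalar_prod_distrib[of _ n] scalar_prod_add_distrib[of _ n])
    then have "k * (v \<bullet> (R *\<^sub>v v) + v \<bullet> (Q *\<^sub>v v)) = 0"
      unfolding kv using Rv Qv v(1)
      by (simp add: scalar_prod_add_distrib[of _ n] distrib_left del: mult_eq_0_iff)
    then show "k = 0" using R(3)[OF v(1,2)] Q(3)[OF v(1,2)] by simp
  qed
  show "R = Q"
  proof (rule eq_matI)
    fix i j assume "i < dim_row Q" "j < dim_col Q"
    then show "R $$ (i, j) = Q $$ (i, j)"
      using arg_cong[OF \<open>R - Q = 0\<^sub>m n n\<close>, of "\<lambda>M. M $$ (i, j)"] R Q by simp
  qed (use R Q in auto)
qed

lemma sqrt_mat_pos_def: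
  assumes "pos_def_mat n B"
  shows "pos_def_mat n (sqrt_mat B)" "sqrt_mat B * sqrt_mat B = B"
proof -
  have n: "dim_row B = n" using pos_def_matD[OF assms] by auto
  have "\<exists>!R. pos_def_mat n R \<and> R * R = B"
    using pos_def_mat_sqrt_exists[OF assms] pos_def_mat_sqrt_unique by metis
  from theI'[OF this] show "pos_def_mat n (sqrt_mat B)" "sqrt_mat B * sqrt_mat B = B"
    by (auto simp: sqrt_mat_def n)
qed

section \<open>Pseudoinverses and range projections\<close>

text \<open>Penrose's argument: \<open>M * X\<close> and \<open>M * Y\<close> are both the
  orthogonal projection onto the range of \<open>M\<close>, and \<open>X * M\<close> and
  \<open>Y * M\<close> the one onto its row space. Hence X = X M X = X M Y = Y M Y = Y.\<close>

lemma is_pinv_unique: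
  assumes X: "is_pinv M X" and Y: "is_pinv M Y"
  shows "X = Y"
proof -
  have d [simp]: "dim_row X = dim_col M" "dim_col X = dim_row M" "dim_row Y = dim_col M" "dim_col Y = dim_row M"
    using X Y by (auto simp: is_pinv_def)
  have XX: "M * (X * M) = M" "X * (M * X) = X" "transpose_mat (M * X) = M * X" "transpose_mat (X * M) = X * M"
    and YY: "M * (Y * M) = M" "Y * (M * Y) = Y" "transpose_mat (M * Y) = M * Y" "transpose_mat (Y * M) = Y * M"
    using X Y by (auto simp: is_pinv_def assoc_mult_mat_dim)
  have "M * X = transpose_mat ((M * (Y * M)) * X)" unfolding YY XX ..
  also have "\<dots> = transpose_mat ((M * Y) * (M * X))" by (simp add: assoc_mult_mat_dim)
  also have "\<dots> = (M * X) * (M * Y)" using XX(3) YY(3) by (subst transpose_mult_dim) auto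
  also have "\<dots> = (M * (X * M)) * Y" by (simp add: assoc_mult_mat_dim)
  finally have MX: "M * X = M * Y" unfolding XX .
  have "X * M = transpose_mat (X * (M * (Y * M)))" unfolding YY XX ..
  also have "\<dots> = transpose_mat ((X * M) * (Y * M))" by (simp add: assoc_mult_mat_dim)
  also have "\<dots> = (Y * M) * (X * M)" using XX(4) YY(4) by (subst transpose_mult_dim) auto
  also have "\<dots> = Y * (M * (X * M))" by (simp add: assoc_mult_mat_dim)
  finally have XM: "X * M = Y * M" unfolding XX .
  have "X = X * M * Y" using XX(2) MX by (simp add: assoc_mult_mat_dim)
  then show ?thesis unfolding XM using YY(2) by (simp add: assoc_mult_mat_dim)
qed

lemma pinv_symmetric:
  assumes M: "M \<in> carrier_mat q q" "transpose_mat M = M"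
  shows "is_pinv M (pinv M)" "transpose_mat (pinv M) = pinv M"
proof -
  obtain U t where "orthogonal_matrix q U" and Mt: "M = orthogonal_matrix.conj_diag q U t"
    using symmetric_spectral[OF M] .
  interpret orthogonal_matrix q U by fact
  \<comment> \<open>With the convention \<open>inverse 0 = 0\<close> this inverts the nonzero
    eigenvalues and keeps the zero ones, which is the pseudoinverse in an eigenbasis.\<close>
  have ex: "is_pinv M (conj_diag (\<lambda>i. inverse (t i)))"
    by (auto simp: is_pinv_def Mt intro!: conj_diag_cong) (metis right_inverse left_inverse)+
  then have "pinv M = conj_diag (\<lambda>i. inverse (t i))"
    unfolding pinv_def using is_pinv_unique by blast
  with ex show "is_pinv M (pinv M)" "transpose_mat (pinv M) = pinv M" by auto
qed

text \<open>The diagonal of \<open>transpose_mat E * E\<close> consists of the squared norms of the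
  columns of \<open>E\<close>.\<close>

lemma transpose_mult_self_zero:
  fixes E :: "real mat"
  assumes E: "E \<in> carrier_mat n k" and 0: "transpose_mat E * E = 0\<^sub>m k k"
  shows "E = 0\<^sub>m n k"
proof (rule eq_matI)
  fix i j assume "i < dim_row (0\<^sub>m n k :: real mat)" "j < dim_col (0\<^sub>m n k :: real mat)"
  then have i: "i < n" and j: "j < k" by auto
  have "col E j \<bullet> col E j = 0"
    using arg_cong[OF 0, of "\<lambda>M. M $$ (j, j)"] E j by simp
  then have "col E j = 0\<^sub>v n" using E by (intro scalar_prod_self_zero) auto
  from arg_cong[OF this, of "\<lambda>v. v $ i"] show "E $$ (i, j) = 0\<^sub>m n k $$ (i, j)"
    using E i j by simp
qed (use E in auto)

definition range_proj :: "real mat \<Rightarrow> real mat" where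
  "range_proj Y = Y * pinv (transpose_mat Y * Y) * transpose_mat Y"

text \<open>The last conclusion prepares the measurability argument: transposed, it puts the range
  of the projection inside that of \<open>Y * transpose_mat Y\<close>, so that the projection can be
  recognised from this product alone.\<close>

lemma range_proj:
  fixes Y :: "real mat"
  assumes Y: "Y \<in> carrier_mat n q"
  shows "range_proj Y \<in> carrier_mat n n"
    "transpose_mat (range_proj Y) = range_proj Y"
    "range_proj Y * range_proj Y = range_proj Y"
    "range_proj Y * Y = Y"
    "\<exists>X \<in> carrier_mat n n. range_proj Y = X * (Y * transpose_mat Y)"
proof -
  define M where "M = transpose_mat Y * Y"
  define X where "X = pinv M"
  have M: "M \<in> carrier_mat q q" "transpose_mat M = M"
    using Y by (auto simp: M_def transpose_mult_dim)
  note p = pinv_symmetric[OF M, folded X_def]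
  have X: "X \<in> carrier_mat q q" using p(1) M by (auto simp: is_pinv_def)
  have [simp]: "dim_row Y = n" "dim_col Y = q" "dim_row M = q" "dim_col M = q" "dim_row X = q" "dim_col X = q"
    using Y M X by auto
  have XMX: "X * (M * X) = X" and MXM: "M * (X * M) = M"
    using p(1) by (auto simp: is_pinv_def assoc_mult_mat_dim)
  have "M * X = transpose_mat (M * X)"
    using p(1) by (simp only: is_pinv_def)
  also have "\<dots> = X * M"
    by (subst transpose_mult_dim) (simp_all add: M(2) p(2))
  finally have comm: "M * X = X * M" .
  have YTY: "transpose_mat Y * (Y * W) = M * W" if "dim_row W = q" for W
    using that by (simp add: M_def assoc_mult_mat_dim)
  have P: "range_proj Y = Y * (X * transpose_mat Y)"
    by (simp add: range_proj_def M_def[symmetric] X_def[symmetric] assoc_mult_mat_dim)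
  show c: "range_proj Y \<in> carrier_mat n n" unfolding P using X Y by simp
  show s: "transpose_mat (range_proj Y) = range_proj Y"
    unfolding P by (simp add: transpose_mult_dim assoc_mult_mat_dim p(2))
  have "range_proj Y * range_proj Y = Y * ((X * (M * X)) * transpose_mat Y)"
    unfolding P by (simp add: assoc_mult_mat_dim YTY)
  then show "range_proj Y * range_proj Y = range_proj Y" unfolding XMX P .
  have PY: "range_proj Y * Y = Y * (X * M)"
    unfolding P by (simp add: assoc_mult_mat_dim M_def)
  \<comment> \<open>The defect \<open>E\<close> is annihilated by \<open>transpose_mat Y\<close>,
    since M X M = M, while \<open>transpose_mat E\<close> is a left multiple of
    \<open>transpose_mat Y\<close>. Therefore \<open>transpose_mat E * E\<close> vanishes.\<close>
  define E where "E = Y * (X * M) - Y"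
  have E: "E \<in> carrier_mat n q" unfolding E_def using Y by (rule minus_carrier_mat)
  have W: "Y * (X * M) \<in> carrier_mat n q" using X Y M by simp
  have YE: "transpose_mat Y * E = 0\<^sub>m q q"
    unfolding E_def using Y W
    by (subst mult_minus_distrib_mat[of _ q n _ q]) (auto simp: YTY MXM M_def[symmetric] minus_r_inv_mat[OF M(1)])
  have "transpose_mat E = (M * X) * transpose_mat Y - transpose_mat Y"
    unfolding E_def using Y W
    by (subst transpose_minus[of _ n q]) (auto simp: transpose_mult_dim p(2) M(2))
  also have "\<dots> * E = (M * X) * transpose_mat Y * E - transpose_mat Y * E"
    using M X Y E by (intro minus_mult_distrib_mat[of _ q n _ _ q]) auto
  also have "(M * X) * transpose_mat Y * E = (M * X) * (transpose_mat Y * E)"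
    using E by (intro assoc_mult_mat_dim) auto
  finally have "transpose_mat E * E = 0\<^sub>m q q"
    unfolding YE using M X by simp
  then have E0: "E = 0\<^sub>m n q" by (rule transpose_mult_self_zero[OF E])
  show "range_proj Y * Y = Y"
  proof (rule eq_matI)
    fix i j assume "i < dim_row Y" "j < dim_col Y"
    then show "(range_proj Y * Y) $$ (i, j) = Y $$ (i, j)"
      using arg_cong[OF E0, of "\<lambda>M. M $$ (i, j)"] unfolding PY E_def by (simp del: index_mult_mat(1))
  qed (use c in auto)
  \<comment> \<open>As \<open>M\<close> commutes with \<open>X\<close>, a factor
    \<open>M = transpose_mat Y * Y\<close> can be moved to the right end, where its \<open>Y\<close>
    meets the outer \<open>transpose_mat Y\<close>.\<close>
  have "X = X * (X * M)" using XMX comm by simp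
  then have "range_proj Y = Y * ((X * (X * M)) * transpose_mat Y)" unfolding P by simp
  also have "\<dots> = (Y * (X * (X * transpose_mat Y))) * (Y * transpose_mat Y)"
    by (simp add: assoc_mult_mat_dim M_def)
  finally show "\<exists>X \<in> carrier_mat n n. range_proj Y = X * (Y * transpose_mat Y)"
    using X Y by (intro bexI[of _ "Y * (X * (X * transpose_mat Y))"]) auto
qed

section \<open>Rank and trace\<close>

text \<open>The span of the columns and \<open>mat_kernel V\<close> are the image and the kernel of
  the linear map given by \<open>V\<close>, to which the abstract dimension formula applies.\<close>

lemma rank_nullity:
  fixes V :: "real mat"
  assumes V: "V \<in> carrier_mat q n"
  shows "rank_mat V + kernel.dim n V = n"
proof -
  interpret W: vec_space "TYPE(real)" q .
  interpret D: vec_space "TYPE(real)" n .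
  interpret L: linear_map class_ring "module_vec TYPE(real) n" "module_vec TYPE(real) q" "\<lambda>v. V *\<^sub>v v"
  proof unfold_locales
    show "(\<lambda>v. V *\<^sub>v v) \<in> module_hom class_ring (module_vec TYPE(real) n) (module_vec TYPE(real) q)"
      using V by (auto simp: module_hom_def module_vec_simps mult_add_distrib_mat_vec mult_mat_vec)
  qed
  have im: "L.imT = W.span (set (cols V))"
    using W.col_space_eq[OF V] V unfolding W.col_space_def L.im_def
    by (auto simp: module_vec_simps)
  have ker: "L.kerT = mat_kernel V"
    using V by (auto simp: L.ker_def mat_kernel_def module_vec_simps)
  have "vectorspace.dim class_ring (module_vec TYPE(real) q\<lparr>carrier := L.imT\<rparr>) + vectorspace.dim class_ring (module_vec TYPE(real) n\<lparr>carrier := L.kerT\<rparr>) = D.dim"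
    by (rule L.rank_nullity_main(1)) (rule D.fin_dim)
  then show ?thesis
    using V unfolding im ker by (simp add: rank_mat_def W.rank_def D.dim_is_n)
qed

lemma jordan_matrix_singletons:
  "jordan_matrix (map (\<lambda>i. (1, t i)) xs) = mat_diag (length xs) (\<lambda>i. t (xs ! i))"
proof (induction xs)
  case Nil
  show ?case by (intro eq_matI) auto
next
  case (Cons x xs)
  have s: "sum_list (map fst (map (\<lambda>i. (1 :: nat, t i)) xs)) = length xs" by (induction xs) auto
  show ?case
    unfolding list.map jordan_matrix_Cons s Cons.IH
    by (rule eq_matI) (auto simp: four_block_mat_def Let_def mat_diag_def nth_Cons split: nat.split)
qed

text \<open>A diagonal matrix is a Jordan matrix with blocks of size one. Its kernel is the
  generalised eigenspace of order 1 for the eigenvalue 0, whose dimension counts the blocks with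
  entry 0.\<close>

lemma kernel_dim_mat_diag:
  "kernel.dim n (mat_diag n (t :: nat \<Rightarrow> real)) = card {i. i < n \<and> t i = 0}"
proof -
  have D: "mat_diag n t = jordan_matrix (map (\<lambda>i. (1, t i)) [0..<n])"
    unfolding jordan_matrix_singletons by (auto simp: mat_diag_def intro!: eq_matI)
  have "char_matrix (mat_diag n t) 0 ^\<^sub>m 1 = mat_diag n t"
    by (auto simp: char_matrix_def mat_diag_def intro!: eq_matI)
  then have "kernel.dim n (mat_diag n t) = dim_gen_eigenspace (mat_diag n t) 0 1"
    by (simp add: dim_gen_eigenspace_def kernel_dim_def)
  also have "\<dots> = length (filter (\<lambda>i. t i = 0) [0..<n])"
    unfolding D dim_gen_eigenspace_jordan_matrix
    by (simp add: filter_map o_def sum_list_triv)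
  also have "\<dots> = card {i. i < n \<and> t i = 0}"
    by (subst distinct_card[symmetric]) (auto intro!: arg_cong[of _ _ card])
  finally show ?thesis .
qed

text \<open>Idempotence leaves only the eigenvalues 0 and 1; the trace counts the ones and the
  kernel dimension the zeros. The additive form matches \<open>rank_nullity\<close>.\<close>

lemma trace_symmetric_idempotent:
  fixes Q :: "real mat"
  assumes Q: "Q \<in> carrier_mat n n" "transpose_mat Q = Q" and idem: "Q * Q = Q"
  shows "mat_trace Q + real (kernel.dim n Q) = real n"
proof -
  obtain U t where "orthogonal_matrix n U" and Qt: "Q = orthogonal_matrix.conj_diag n U t"
    using symmetric_spectral[OF Q] .
  interpret orthogonal_matrix n U by fact
  have t: "t i = 0 \<or> t i = 1" if "i < n" for i
  proof -
    have "eigenvalue Q (t i)" using that by (auto simp: Qt eigenvalue_conj_diag)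
    then obtain v where v: "v \<in> carrier_vec n" "v \<noteq> 0\<^sub>v n" "Q *\<^sub>v v = t i \<cdot>\<^sub>v v"
      using eigenvalue_vector[OF Q(1)] by blast
    have "(Q * Q) *\<^sub>v v = Q *\<^sub>v (Q *\<^sub>v v)" using Q(1) v(1) by (intro assoc_mult_mat_vec) auto
    then have "t i \<cdot>\<^sub>v v = t i \<cdot>\<^sub>v (t i \<cdot>\<^sub>v v)"
      unfolding idem v(3) using mult_mat_vec[OF Q(1) v(1)] v(3) by simp
    then have "v \<bullet> (t i \<cdot>\<^sub>v v) = v \<bullet> (t i \<cdot>\<^sub>v (t i \<cdot>\<^sub>v v))" by simp
    then have "t i * (v \<bullet> v) = t i * (t i * (v \<bullet> v))" using v(1) by simp
    then show ?thesis using scalar_prod_self_pos[OF v(1,2)] by auto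
  qed
  have "kernel.dim n Q = card {i. i < n \<and> t i = 0}"
    unfolding Qt kernel_dim_mat_diag[symmetric]
    by (rule similar_mat_wit_kernel_dim[OF conj_diag_carrier similar_conj_diag])
  also have "real \<dots> = (\<Sum>i<n. if t i = 0 then 1 else 0)"
    by (simp add: sum.If_cases lessThan_def Int_def conj_commute)
  finally have "mat_trace Q + real (kernel.dim n Q) = (\<Sum>i<n. t i + (if t i = 0 then 1 else 0))"
    by (simp add: Qt trace_conj_diag sum.distrib)
  also have "\<dots> = (\<Sum>i<n. 1)" using t by (intro sum.cong) auto
  finally show ?thesis by simp
qed

text \<open>Ranks are compared through kernels. \<open>transpose_mat Y * R\<close> and
  \<open>range_proj Y * R\<close> are left multiples of each other, so their kernels coincide, and
  the invertible factor \<open>R\<close> on the right does not change the kernel dimension.\<close>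

lemma rank_eq_trace_range_proj:
  assumes Y: "Y \<in> carrier_mat n q" and R: "R \<in> carrier_mat n n" "C \<in> carrier_mat n n"
    and RC: "R * C = 1\<^sub>m n"
  shows "real (rank_mat (transpose_mat Y * R)) = mat_trace (range_proj Y)"
proof -
  note P = range_proj[OF Y]
  have d: "dim_row Y = n" "dim_col Y = q" "dim_row R = n" "dim_col R = n"
    "dim_row (range_proj Y) = n" "dim_col (range_proj Y) = n"
    using Y R P(1) by auto
  have X: "pinv (transpose_mat Y * Y) \<in> carrier_mat q q"
    using pinv_symmetric(1)[of "transpose_mat Y * Y" q] Y
    by (auto simp: is_pinv_def transpose_mult_dim)
  have YP: "transpose_mat Y * R = transpose_mat Y * (range_proj Y * R)"
  proof -
    have "transpose_mat Y = transpose_mat Y * range_proj Y"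
      using arg_cong[OF P(4), of transpose_mat] by (simp add: transpose_mult_dim d P(2))
    then have "transpose_mat Y * R = transpose_mat Y * range_proj Y * R" by simp
    then show ?thesis by (simp add: assoc_mult_mat_dim d)
  qed
  have PY: "range_proj Y * R = (Y * pinv (transpose_mat Y * Y)) * (transpose_mat Y * R)"
    using X by (simp add: range_proj_def assoc_mult_mat_dim d)
  have YR: "transpose_mat Y * R \<in> carrier_mat q n" and PR: "range_proj Y * R \<in> carrier_mat n n"
    using Y R P(1) by auto
  have "mat_kernel (transpose_mat Y * R) = mat_kernel (range_proj Y * R)"
  proof
    show "mat_kernel (transpose_mat Y * R) \<subseteq> mat_kernel (range_proj Y * R)"
      unfolding PY using X Y by (intro mat_kernel_mult_subset[OF YR]) auto
    show "mat_kernel (range_proj Y * R) \<subseteq> mat_kernel (transpose_mat Y * R)"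
      unfolding YP using Y by (intro mat_kernel_mult_subset[OF PR]) auto
  qed
  then have "kernel.dim n (transpose_mat Y * R) = kernel.dim n (range_proj Y * R)" by simp
  also have "\<dots> = kernel.dim n (range_proj Y)"
    by (rule mat_kernel_dim_mult_eq_right[OF P(1) R RC])
  finally have "kernel.dim n (transpose_mat Y * R) = kernel.dim n (range_proj Y)" .
  then show ?thesis
    using rank_nullity[OF YR] trace_symmetric_idempotent[OF P(1-3)] by linarith
qed

text \<open>The orthogonal projection onto the range of \<open>Y\<close> is the limit of a polynomial in
  \<open>Y Y\<^sup>T\<close>; this is what makes it a measurable function of \<open>Y Y\<^sup>T\<close>.\<close>

lemma range_proj_limit:
  fixes Y :: "real mat"
  assumes Y: "Y \<in> carrier_mat n q" and ij: "i < n" "j < n"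
  defines "G \<equiv> Y * transpose_mat Y"
  assumes c: "c = 1 + mat_trace G"
  shows "(\<lambda>N. (1\<^sub>m n - ((1\<^sub>m n - (1 / c) \<cdot>\<^sub>m G) ^\<^sub>m N)) $$ (i, j)) \<longlonglongrightarrow> range_proj Y $$ (i, j)"
proof -
  have G: "G \<in> carrier_mat n n" "transpose_mat G = G"
    using Y by (auto simp: G_def transpose_mult_dim)
  note P = range_proj[OF Y]
  obtain U t where "orthogonal_matrix n U" and Gt: "G = orthogonal_matrix.conj_diag n U t"
    using symmetric_spectral[OF G] .
  interpret orthogonal_matrix n U by fact
  have t0: "0 \<le> t k" if "k < n" for k
  proof -
    have "eigenvalue G (t k)" using that by (auto simp: Gt eigenvalue_conj_diag)
    then obtain v where v: "v \<in> carrier_vec n" "v \<noteq> 0\<^sub>v n" "G *\<^sub>v v = t k \<cdot>\<^sub>v v"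
      using eigenvalue_vector[OF G(1)] by blast
    have Yv: "transpose_mat Y *\<^sub>v v \<in> carrier_vec q" using Y v(1) by (intro mult_mat_vec_carrier[of _ q n]) auto
    have "G *\<^sub>v v = Y *\<^sub>v (transpose_mat Y *\<^sub>v v)"
      unfolding G_def using Y v(1) by (intro assoc_mult_mat_vec) auto
    then have "v \<bullet> (G *\<^sub>v v) = (transpose_mat Y *\<^sub>v v) \<bullet> (transpose_mat Y *\<^sub>v v)"
      using transpose_vec_mult_scalar[OF Y Yv v(1)] by simp
    then have "0 \<le> t k * (v \<bullet> v)"
      using scalar_prod_self_nonneg v by simp
    then show ?thesis using scalar_prod_self_pos[OF v(1,2)] by (simp add: zero_le_mult_iff)
  qed
  \<comment> \<open>The trace is the sum of the nonnegative eigenvalues and bounds each of them. The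
    added 1 makes the bound strict and keeps \<open>c\<close> positive even for
    \<open>G = 0\<close>, so every \<open>1 - t k / c\<close> lies in the interval (0, 1].\<close>
  have tc: "t k < c" if "k < n" for k
  proof -
    have "t k \<le> (\<Sum>k<n. t k)" using that t0 by (intro member_le_sum) auto
    then show ?thesis by (simp add: c Gt trace_conj_diag)
  qed
  have entry_diff: "1\<^sub>m n - conj_diag f = conj_diag (\<lambda>k. 1 - f k)" for f
    unfolding conj_diag_one[symmetric]
    by (rule eq_matI) (auto simp: conj_diag_entry sum_subtractf[symmetric] algebra_simps)
  have "(1 / c) \<cdot>\<^sub>m G = conj_diag (\<lambda>k. t k / c)"
    by (rule eq_matI) (auto simp: Gt conj_diag_entry sum_divide_distrib intro!: sum.cong)
  then have "1\<^sub>m n - (1 / c) \<cdot>\<^sub>m G = conj_diag (\<lambda>k. 1 - t k / c)"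
    by (simp add: entry_diff)
  moreover have "conj_diag f ^\<^sub>m N = conj_diag (\<lambda>k. f k ^ N)" for f N
    by (induction N) (simp_all add: conj_diag_one mult.commute)
  ultimately have lhs: "1\<^sub>m n - ((1\<^sub>m n - (1 / c) \<cdot>\<^sub>m G) ^\<^sub>m N) = conj_diag (\<lambda>k. 1 - (1 - t k / c) ^ N)" for N
    by (simp add: entry_diff)
  \<comment> \<open>The spectral projection off the kernel of \<open>G\<close>, which is the limit
    of the polynomials; \<open>H\<close> is the pseudoinverse of \<open>G\<close>. It agrees with
    \<open>range_proj Y\<close> because each of the two absorbs the other: P Q = Q and Q P = P, and
    transposing the first identity turns its left side into Q P.\<close>
  define Q where "Q = conj_diag (\<lambda>k. if t k = 0 then 0 else 1)"
  have Q: "Q \<in> carrier_mat n n" "transpose_mat Q = Q" by (auto simp: Q_def)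
  define H where "H = conj_diag (\<lambda>k. inverse (t k))"
  have H: "H \<in> carrier_mat n n" by (simp add: H_def)
  have QGH: "Q = G * H" by (auto simp: Q_def Gt H_def intro!: conj_diag_cong)
  have QG: "Q * G = G" by (auto simp: Q_def Gt intro!: conj_diag_cong)
  have d: "dim_row Y = n" "dim_col Y = q" "dim_row G = n" "dim_col G = n" "dim_row Q = n" "dim_col Q = n"
    "dim_row (range_proj Y) = n" "dim_col (range_proj Y) = n" "dim_row H = n"
    using Y G P(1) Q H by auto
  have PG: "range_proj Y * G = G"
    using P(4) by (simp add: G_def assoc_mult_mat_dim[symmetric] d)
  obtain X where X: "X \<in> carrier_mat n n" "range_proj Y = X * G"
    using P(5) by (auto simp: G_def)
  have PX: "range_proj Y = G * transpose_mat X"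
    using arg_cong[OF X(2), of transpose_mat] X(1) by (simp add: transpose_mult_dim d P(2) G(2))
  have "range_proj Y * Q = (range_proj Y * G) * H"
    unfolding QGH using H by (simp add: assoc_mult_mat_dim d)
  then have 1: "range_proj Y * Q = Q" unfolding PG by (simp add: QGH)
  have "Q * range_proj Y = (Q * G) * transpose_mat X"
    unfolding PX using X(1) by (simp add: assoc_mult_mat_dim d)
  then have 2: "Q * range_proj Y = range_proj Y" unfolding QG by (simp add: PX)
  have "transpose_mat (range_proj Y * Q) = Q * range_proj Y"
    by (simp add: transpose_mult_dim d P(2) Q(2))
  then have PQ: "range_proj Y = Q" unfolding 1 2 Q(2) by simp
  show ?thesis
    unfolding lhs PQ Q_def conj_diag_entry[OF ij]
  proof (intro tendsto_sum tendsto_mult tendsto_const)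
    fix k assume "k \<in> {..<n}"
    then have k: "k < n" by simp
    show "(\<lambda>N. 1 - (1 - t k / c) ^ N) \<longlonglongrightarrow> (if t k = 0 then 0 else 1)"
    proof (cases "t k = 0")
      case False
      then have "norm (1 - t k / c) < 1" using t0[OF k] tc[OF k] by (auto simp: field_simps)
      from tendsto_diff[OF tendsto_const[of 1] LIMSEQ_power_zero[OF this]] show ?thesis
        using False by simp
    qed simp
  qed
qed

section \<open>Random matrices\<close>

definition measurable_mat :: "'w measure \<Rightarrow> nat \<Rightarrow> nat \<Rightarrow> ('w \<Rightarrow> real mat) \<Rightarrow> bool" where
  "measurable_mat P r c X \<longleftrightarrow> (\<forall>w \<in> space P. X w \<in> carrier_mat r c) \<and>
     (\<forall>i < r. \<forall>j < c. (\<lambda>w. X w $$ (i, j)) \<in> borel_measurable P)"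

lemma measurable_mat_const: "M \<in> carrier_mat r c \<Longrightarrow> measurable_mat P r c (\<lambda>_. M)"
  by (simp add: measurable_mat_def)

lemma measurable_mat_mult:
  assumes "measurable_mat P r k X" "measurable_mat P k c Y"
  shows "measurable_mat P r c (\<lambda>w. X w * Y w)"
  unfolding measurable_mat_def
proof (intro conjI allI impI ballI)
  show "X w * Y w \<in> carrier_mat r c" if "w \<in> space P" for w
    using assms that by (auto simp: measurable_mat_def)
  fix i j assume ij: "i < r" "j < c"
  have "(\<lambda>w. X w $$ (i, l)) \<in> borel_measurable P" "(\<lambda>w. Y w $$ (l, j)) \<in> borel_measurable P"
    if "l < k" for l
    using assms ij that by (auto simp: measurable_mat_def)
  then have "(\<lambda>w. \<Sum>l<k. X w $$ (i, l) * Y w $$ (l, j)) \<in> borel_measurable P"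
    by (intro borel_measurable_sum borel_measurable_times) auto
  moreover have "(X w * Y w) $$ (i, j) = (\<Sum>l<k. X w $$ (i, l) * Y w $$ (l, j))" if "w \<in> space P" for w
  proof -
    have "X w \<in> carrier_mat r k" "Y w \<in> carrier_mat k c"
      using assms that by (auto simp: measurable_mat_def)
    then show ?thesis using ij by (simp add: scalar_prod_def atLeast0LessThan)
  qed
  ultimately show "(\<lambda>w. (X w * Y w) $$ (i, j)) \<in> borel_measurable P"
    by (subst measurable_cong) auto
qed

lemma measurable_mat_minus:
  assumes "measurable_mat P r c X" "measurable_mat P r c Y"
  shows "measurable_mat P r c (\<lambda>w. X w - Y w)"
  unfolding measurable_mat_def
proof (intro conjI allI impI ballI)
  show "X w - Y w \<in> carrier_mat r c" if "w \<in> space P" for w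
    using assms that by (intro minus_carrier_mat) (auto simp: measurable_mat_def)
  fix i j assume ij: "i < r" "j < c"
  have "(X w - Y w) $$ (i, j) = X w $$ (i, j) - Y w $$ (i, j)" if "w \<in> space P" for w
  proof -
    have "Y w \<in> carrier_mat r c" using assms that by (auto simp: measurable_mat_def)
    then show ?thesis using ij by simp
  qed
  moreover have "(\<lambda>w. X w $$ (i, j) - Y w $$ (i, j)) \<in> borel_measurable P"
    using assms ij by (intro borel_measurable_diff) (auto simp: measurable_mat_def)
  ultimately show "(\<lambda>w. (X w - Y w) $$ (i, j)) \<in> borel_measurable P"
    by (subst measurable_cong) auto
qed

lemma measurable_mat_smult:
  assumes "f \<in> borel_measurable P" "measurable_mat P r c X"
  shows "measurable_mat P r c (\<lambda>w. f w \<cdot>\<^sub>m X w)"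
  unfolding measurable_mat_def
proof (intro conjI allI impI ballI)
  show "f w \<cdot>\<^sub>m X w \<in> carrier_mat r c" if "w \<in> space P" for w
    using assms that by (auto simp: measurable_mat_def)
  fix i j assume ij: "i < r" "j < c"
  have "(f w \<cdot>\<^sub>m X w) $$ (i, j) = f w * X w $$ (i, j)" if "w \<in> space P" for w
  proof -
    have "X w \<in> carrier_mat r c" using assms that by (auto simp: measurable_mat_def)
    then show ?thesis using ij by simp
  qed
  moreover have "(\<lambda>w. f w * X w $$ (i, j)) \<in> borel_measurable P"
    using assms ij by (intro borel_measurable_times) (auto simp: measurable_mat_def)
  ultimately show "(\<lambda>w. (f w \<cdot>\<^sub>m X w) $$ (i, j)) \<in> borel_measurable P"
    by (subst measurable_cong) auto
qed

lemma measurable_mat_power: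
  assumes "measurable_mat P n n X"
  shows "measurable_mat P n n (\<lambda>w. X w ^\<^sub>m N)"
proof (induction N)
  case 0
  have "(X w ^\<^sub>m 0) = 1\<^sub>m n" if "w \<in> space P" for w
    using assms that by (auto simp: measurable_mat_def)
  then show ?case
    by (auto simp: measurable_mat_def simp del: pow_mat.simps cong: measurable_cong)
next
  case (Suc N)
  then show ?case using measurable_mat_mult[OF Suc assms] by simp
qed

lemma measurable_mat_trace:
  assumes "measurable_mat P n n X"
  shows "(\<lambda>w. mat_trace (X w)) \<in> borel_measurable P"
proof -
  have "mat_trace (X w) = (\<Sum>i<n. X w $$ (i, i))" if "w \<in> space P" for w
    using assms that by (auto simp: mat_trace_def measurable_mat_def)
  moreover have "(\<lambda>w. \<Sum>i<n. X w $$ (i, i)) \<in> borel_measurable P"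
    using assms by (intro borel_measurable_sum) (auto simp: measurable_mat_def)
  ultimately show ?thesis by (subst measurable_cong) auto
qed

text \<open>The shape of \<open>S\<close> depends on the outcome, but its product with its transpose
  is always m by m. On each event \<open>q w = k\<close> its entries are finite sums of products of
  measurable functions, and there are countably many such events.\<close>

lemma random_mat_gram_measurable:
  assumes "random_mat P m q S"
  shows "measurable_mat P m m (\<lambda>w. S w * transpose_mat (S w))"
  unfolding measurable_mat_def
proof (intro conjI allI impI ballI)
  have S: "S w \<in> carrier_mat m (q w)" if "w \<in> space P" for w
    using assms that by (auto simp: random_mat_def)
  show "S w * transpose_mat (S w) \<in> carrier_mat m m" if "w \<in> space P" for w
    using S[OF that] by auto
  have q: "q \<in> measurable P (count_space UNIV)" using assms by (auto simp: random_mat_def)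
  define E where "E k = {w \<in> space P. q w = k}" for k
  have E: "E k \<inter> space P \<in> sets P" for k
  proof -
    have "E k \<inter> space P = q -` {k} \<inter> space P" by (auto simp: E_def)
    then show ?thesis using measurable_sets[OF q, of "{k}"] by simp
  qed
  \<comment> \<open>Extension by zero turns measurability on the restricted space into measurability
    on \<open>P\<close>.\<close>
  define s where "s k i l w = S w $$ (i, l) * indicator (E k) w" for k i l w
  have s: "s k i l \<in> borel_measurable P" if "i < m" "l < k" for k i l
    using assms that borel_measurable_restrict_space_iff[OF E, of "\<lambda>w. S w $$ (i, l)" k]
    by (auto simp: random_mat_def E_def s_def[abs_def] mult.commute)
  fix i j assume ij: "i < m" "j < m"
  have "(\<lambda>w. \<Sum>l<k. s k i l w * s k j l w) \<in> borel_measurable P" for k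
    using ij s by (intro borel_measurable_sum borel_measurable_times) auto
  \<comment> \<open>The sum is measurable for every fixed number of columns; substituting the
    countably valued measurable \<open>q\<close> preserves this.\<close>
  then have "(\<lambda>w. \<Sum>l<q w. s (q w) i l w * s (q w) j l w) \<in> borel_measurable P"
    by (rule measurable_compose_countable[OF _ q])
  moreover have "(S w * transpose_mat (S w)) $$ (i, j) = (\<Sum>l<q w. s (q w) i l w * s (q w) j l w)"
    if "w \<in> space P" for w
    using S[OF that] ij that by (simp add: scalar_prod_def s_def E_def atLeast0LessThan)
  ultimately show "(\<lambda>w. (S w * transpose_mat (S w)) $$ (i, j)) \<in> borel_measurable P"
    by (subst measurable_cong) auto
qed

text \<open>Measurability is assumed of \<open>Y w * transpose_mat (Y w)\<close>, whose size is
  fixed. Polynomials in it, scaled by its trace, are measurable, and pointwise limits inherit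
  this.\<close>

lemma range_proj_measurable:
  assumes Y: "\<And>w. w \<in> space P \<Longrightarrow> Y w \<in> carrier_mat n (q w)"
    and G: "measurable_mat P n n (\<lambda>w. Y w * transpose_mat (Y w))"
  shows "measurable_mat P n n (\<lambda>w. range_proj (Y w))"
  unfolding measurable_mat_def
proof (intro conjI allI impI ballI)
  show "range_proj (Y w) \<in> carrier_mat n n" if "w \<in> space P" for w
    using range_proj(1)[OF Y[OF that]] .
  fix i j assume ij: "i < n" "j < n"
  define c where "c w = 1 + mat_trace (Y w * transpose_mat (Y w))" for w
  have "(\<lambda>w. 1 / c w) \<in> borel_measurable P"
    using measurable_mat_trace[OF G] by (simp add: c_def)
  then have "measurable_mat P n n
    (\<lambda>w. 1\<^sub>m n - (1\<^sub>m n - (1 / c w) \<cdot>\<^sub>m (Y w * transpose_mat (Y w))) ^\<^sub>m N)" for N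
    using G by (intro measurable_mat_minus measurable_mat_power measurable_mat_smult measurable_mat_const) auto
  then have "(\<lambda>w. (1\<^sub>m n - (1\<^sub>m n - (1 / c w) \<cdot>\<^sub>m (Y w * transpose_mat (Y w))) ^\<^sub>m N) $$ (i, j))
    \<in> borel_measurable P" for N
    using ij by (simp add: measurable_mat_def)
  then show "(\<lambda>w. range_proj (Y w) $$ (i, j)) \<in> borel_measurable P"
    by (rule borel_measurable_LIMSEQ_real[rotated])
       (rule range_proj_limit[OF Y ij c_def])
qed

text \<open>A diagonal entry is the squared norm of its row, hence at least its own square and so at
  most 1; it also bounds the square of every entry in that row.\<close>

lemma symmetric_idempotent_entry_bound:
  fixes Q :: "real mat"
  assumes Q: "Q \<in> carrier_mat n n" "transpose_mat Q = Q" "Q * Q = Q" and ij: "i < n" "j < n"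
  shows "\<bar>Q $$ (i, j)\<bar> \<le> 1"
proof -
  have sym: "Q $$ (k, i) = Q $$ (i, k)" if "k < n" for k
    using arg_cong[OF Q(2), of "\<lambda>M. M $$ (i, k)"] Q(1) ij that by simp
  have "Q $$ (i, i) = (\<Sum>k<n. Q $$ (i, k) * Q $$ (k, i))"
    using arg_cong[OF Q(3), of "\<lambda>M. M $$ (i, i)"] Q(1) ij by (simp add: scalar_prod_def atLeast0LessThan)
  also have "\<dots> = (\<Sum>k<n. (Q $$ (i, k))\<^sup>2)"
    using sym by (intro sum.cong) (auto simp: power2_eq_square)
  finally have ii: "Q $$ (i, i) = (\<Sum>k<n. (Q $$ (i, k))\<^sup>2)" .
  have le: "(Q $$ (i, k))\<^sup>2 \<le> Q $$ (i, i)" if "k < n" for k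
    unfolding ii by (rule member_le_sum) (use that in auto)
  have "Q $$ (i, i) \<le> 1"
  proof (rule ccontr)
    assume "\<not> ?thesis"
    then have "1 * Q $$ (i, i) < Q $$ (i, i) * Q $$ (i, i)" by (intro mult_strict_right_mono) auto
    then show False using le[OF ij(1)] by (simp add: power2_eq_square)
  qed
  then have "(Q $$ (i, j))\<^sup>2 \<le> 1" using le[OF ij(2)] by linarith
  then show ?thesis by (simp add: abs_square_le_1)
qed

section \<open>Entrywise expectations of matrices of fixed size\<close>

definition integrable_mat :: "'w measure \<Rightarrow> nat \<Rightarrow> nat \<Rightarrow> ('w \<Rightarrow> real mat) \<Rightarrow> bool" where
  "integrable_mat P r c X \<longleftrightarrow> (\<forall>w \<in> space P. X w \<in> carrier_mat r c) \<and>
     (\<forall>i < r. \<forall>j < c. integrable P (\<lambda>w. X w $$ (i, j)))"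

lemma expect_mat_carrier [simp]: "expect_mat P r c X \<in> carrier_mat r c"
  by (simp add: expect_mat_def)

lemma expect_mat_cong:
  "(\<And>w. w \<in> space P \<Longrightarrow> X w = Y w) \<Longrightarrow> expect_mat P r c X = expect_mat P r c Y"
  by (auto simp: expect_mat_def intro!: eq_matI Bochner_Integration.integral_cong)

lemma expect_mat_mult_left:
  assumes L: "L \<in> carrier_mat r k" and X: "integrable_mat P k c X"
  shows "expect_mat P r c (\<lambda>w. L * X w) = L * expect_mat P k c X"
    and "integrable_mat P r c (\<lambda>w. L * X w)"
proof -
  have Xc: "X w \<in> carrier_mat k c" if "w \<in> space P" for w
    using X that by (auto simp: integrable_mat_def)
  have Xi: "integrable P (\<lambda>w. X w $$ (l, j))" if "l < k" "j < c" for l j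
    using X that by (auto simp: integrable_mat_def)
  have entry: "(L * X w) $$ (i, j) = (\<Sum>l<k. L $$ (i, l) * X w $$ (l, j))"
    if "w \<in> space P" "i < r" "j < c" for w i j
    using L Xc[OF that(1)] that by (simp add: scalar_prod_def atLeast0LessThan)
  show "expect_mat P r c (\<lambda>w. L * X w) = L * expect_mat P k c X"
  proof (rule eq_matI)
    fix i j assume "i < dim_row (L * expect_mat P k c X)" "j < dim_col (L * expect_mat P k c X)"
    then have ij: "i < r" "j < c" using L by (auto simp: expect_mat_def)
    have "expect_mat P r c (\<lambda>w. L * X w) $$ (i, j)
      = (\<integral>w. (\<Sum>l<k. L $$ (i, l) * X w $$ (l, j)) \<partial>P)"
      using ij entry by (auto simp: expect_mat_def intro!: Bochner_Integration.integral_cong)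
    also have "\<dots> = (\<Sum>l<k. L $$ (i, l) * (\<integral>w. X w $$ (l, j) \<partial>P))"
      using Xi ij by (subst Bochner_Integration.integral_sum) auto
    also have "\<dots> = (L * expect_mat P k c X) $$ (i, j)"
      using ij L by (simp add: expect_mat_def scalar_prod_def atLeast0LessThan)
    finally show "expect_mat P r c (\<lambda>w. L * X w) $$ (i, j) = (L * expect_mat P k c X) $$ (i, j)" .
  qed (use L in \<open>auto simp: expect_mat_def\<close>)
  show "integrable_mat P r c (\<lambda>w. L * X w)"
    unfolding integrable_mat_def
  proof (intro conjI ballI allI impI)
    show "L * X w \<in> carrier_mat r c" if "w \<in> space P" for w using L Xc[OF that] by simp
    fix i j assume ij: "i < r" "j < c"
    have "integrable P (\<lambda>w. \<Sum>l<k. L $$ (i, l) * X w $$ (l, j))"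
      using Xi ij by (intro Bochner_Integration.integrable_sum integrable_mult_right) auto
    then show "integrable P (\<lambda>w. (L * X w) $$ (i, j))"
      using ij entry by (subst Bochner_Integration.integrable_cong) auto
  qed
qed

text \<open>Combined with \<open>expect_mat_mult_left\<close>, this also moves constant factors out
  of the expectation on the right.\<close>

lemma expect_mat_transpose:
  "expect_mat P c r (\<lambda>w. transpose_mat (X w)) = transpose_mat (expect_mat P r c X)"
  if "\<And>w. w \<in> space P \<Longrightarrow> X w \<in> carrier_mat r c"
proof (rule eq_matI)
  fix i j assume "i < dim_row (transpose_mat (expect_mat P r c X))" "j < dim_col (transpose_mat (expect_mat P r c X))"
  then have ij: "i < c" "j < r" by (auto simp: expect_mat_def)
  have "transpose_mat (X w) $$ (i, j) = X w $$ (j, i)" if "w \<in> space P" for w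
    using \<open>\<And>w. w \<in> space P \<Longrightarrow> X w \<in> carrier_mat r c\<close>[OF that] ij by simp
  then show "expect_mat P c r (\<lambda>w. transpose_mat (X w)) $$ (i, j) = transpose_mat (expect_mat P r c X) $$ (i, j)"
    using ij by (auto simp: expect_mat_def intro!: Bochner_Integration.integral_cong)
qed (auto simp: expect_mat_def)

lemma integrable_mat_transpose:
  assumes "integrable_mat P r c X"
  shows "integrable_mat P c r (\<lambda>w. transpose_mat (X w))"
  unfolding integrable_mat_def
proof (intro conjI ballI allI impI)
  fix i j assume ij: "i < c" "j < r"
  have "transpose_mat (X w) $$ (i, j) = X w $$ (j, i)" if "w \<in> space P" for w
    using assms ij that by (auto simp: integrable_mat_def)
  then show "integrable P (\<lambda>w. transpose_mat (X w) $$ (i, j))"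
    using assms ij by (subst Bochner_Integration.integrable_cong[OF refl]) (auto simp: integrable_mat_def)
qed (use assms in \<open>auto simp: integrable_mat_def\<close>)

lemma expect_mat_trace:
  assumes "integrable_mat P n n X"
  shows "mat_trace (expect_mat P n n X) = (\<integral>w. mat_trace (X w) \<partial>P)"
proof -
  have "(\<integral>w. mat_trace (X w) \<partial>P) = (\<integral>w. (\<Sum>i<n. X w $$ (i, i)) \<partial>P)"
    using assms by (intro Bochner_Integration.integral_cong) (auto simp: integrable_mat_def mat_trace_def)
  also have "\<dots> = (\<Sum>i<n. \<integral>w. X w $$ (i, i) \<partial>P)"
    using assms by (intro Bochner_Integration.integral_sum) (auto simp: integrable_mat_def)
  finally show ?thesis by (simp add: mat_trace_def expect_mat_def)
qed

text \<open>Passes positive semidefiniteness from the single outcomes to the mean.\<close>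

lemma expect_mat_quadratic_form:
  assumes X: "integrable_mat P n n X" and v: "v \<in> carrier_vec n"
  shows "v \<bullet> (expect_mat P n n X *\<^sub>v v) = (\<integral>w. v \<bullet> (X w *\<^sub>v v) \<partial>P)"
proof -
  have q: "v \<bullet> (M *\<^sub>v v) = (\<Sum>i<n. \<Sum>j<n. M $$ (i, j) * (v $ i * v $ j))" if "M \<in> carrier_mat n n" for M
    using that v by (auto simp: scalar_prod_def atLeast0LessThan sum_distrib_left ac_simps intro!: sum.cong)
  have Xi: "integrable P (\<lambda>w. X w $$ (l, j))" if "l < n" "j < n" for l j
    using X that by (auto simp: integrable_mat_def)
  have "(\<integral>w. v \<bullet> (X w *\<^sub>v v) \<partial>P) = (\<integral>w. (\<Sum>i<n. \<Sum>j<n. X w $$ (i, j) * (v $ i * v $ j)) \<partial>P)"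
    using X q by (intro Bochner_Integration.integral_cong) (auto simp: integrable_mat_def)
  also have "\<dots> = (\<Sum>i<n. \<Sum>j<n. (\<integral>w. X w $$ (i, j) \<partial>P) * (v $ i * v $ j))"
    using Xi by (subst Bochner_Integration.integral_sum)
      (auto intro!: sum.cong integrable_sum Bochner_Integration.integrable_sum simp: Bochner_Integration.integral_sum)
  also have "\<dots> = v \<bullet> (expect_mat P n n X *\<^sub>v v)"
    by (subst q) (auto simp: expect_mat_def)
  finally show ?thesis by simp
qed

section \<open>Spectral bounds for the mean projection\<close>

theorem lemma4p2:
  fixes P :: "'w measure"
    and m n :: nat
    and A B :: "real mat"
    and q :: "'w \<Rightarrow> nat"
    and S :: "'w \<Rightarrow> real mat"
    and Z :: "'w \<Rightarrow> real mat"
    and d :: "'w \<Rightarrow> nat"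
    and \<rho> :: real
  assumes "prob_space P"
    and "0 < n"
    and "A \<in> carrier_mat m n"
    and "pos_def_mat n B"
    and "random_mat P m q S"
    and "\<And>w. Z w = transpose_mat A * S w
                * pinv (transpose_mat (S w) * A * inv_mat B * transpose_mat A * S w)
                * transpose_mat (S w) * A"
    and "\<And>w. d w = rank_mat (transpose_mat (S w) * A)"
    and "\<rho> = 1 - lambda_min (inv_mat B * expect_mat P n n Z)"
  shows "\<rho> = 1 - lambda_min (inv_mat (sqrt_mat B) * expect_mat P n n Z * inv_mat (sqrt_mat B))
       \<and> 0 \<le> 1 - integral\<^sup>L P (\<lambda>w. real (d w)) / real n
       \<and> 1 - integral\<^sup>L P (\<lambda>w. real (d w)) / real n \<le> \<rho>
       \<and> \<rho> \<le> 1"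
proof -
  interpret prob_space P by fact
  note A = assms(3) and n = assms(2)
  define R where "R = sqrt_mat B"
  define C where "C = inv_mat R"
  have pdR: "pos_def_mat n R" and RR: "R * R = B"
    using sqrt_mat_pos_def[OF assms(4)] by (auto simp: R_def)
  note R = pos_def_matD(1,2)[OF pdR] and C = inv_mat_pos_def[OF pdR, folded C_def]
  have dims [simp]: "dim_row A = m" "dim_col A = n" "dim_row R = n" "dim_col R = n" "dim_row C = n" "dim_col C = n"
    using A R C by auto
  have RC: "R * (C * W) = W" and CR: "C * (R * W) = W" if "dim_row W = n" for W
  proof -
    have W: "W \<in> carrier_mat n (dim_col W)" using that by auto
    show "R * (C * W) = W" "C * (R * W) = W"
      using that C(2,3) W by (simp_all add: assoc_mult_mat_dim[symmetric])
  qed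
  have invB: "inv_mat B = C * C"
    using R C by (intro inv_mat_eqI[of _ n]) (auto simp: RR[symmetric] assoc_mult_mat_dim RC CR)
  have S: "S w \<in> carrier_mat m (q w)" if "w \<in> space P" for w
    using assms(5) that by (auto simp: random_mat_def)
  define Y where "Y w = C * (transpose_mat A * S w)" for w
  define Q where "Q w = range_proj (Y w)" for w
  have Y: "Y w \<in> carrier_mat n (q w)" if "w \<in> space P" for w
    using S[OF that] A C by (auto simp: Y_def)
  have Q: "Q w \<in> carrier_mat n n" "transpose_mat (Q w) = Q w" "Q w * Q w = Q w" if "w \<in> space P" for w
    using range_proj(1-3)[OF Y[OF that]] by (auto simp: Q_def)
  have YT: "transpose_mat (Y w) = transpose_mat (S w) * (A * C)" if "w \<in> space P" for w
    using S[OF that] by (simp add: Y_def transpose_mult_dim C(4) assoc_mult_mat_dim)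
  \<comment> \<open>Only constant matrices surround \<open>S w * transpose_mat (S w)\<close> here,
    so the random number of columns is hidden in the inner product of matrices.\<close>
  have "Y w * transpose_mat (Y w) = (C * transpose_mat A) * (S w * transpose_mat (S w)) * (A * C)"
    if "w \<in> space P" for w
    using S[OF that] unfolding YT[OF that] by (simp add: Y_def assoc_mult_mat_dim)
  moreover have "measurable_mat P n n (\<lambda>w. (C * transpose_mat A) * (S w * transpose_mat (S w)) * (A * C))"
    by (rule measurable_mat_mult[OF measurable_mat_mult[OF measurable_mat_const
          random_mat_gram_measurable[OF assms(5)]] measurable_mat_const]) (auto intro!: carrier_matI)
  ultimately have "measurable_mat P n n (\<lambda>w. Y w * transpose_mat (Y w))"
    by (auto simp: measurable_mat_def cong: measurable_cong)
  then have Qm: "measurable_mat P n n Q"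
    using range_proj_measurable[OF Y] by (simp add: Q_def[abs_def])
  have Qi: "integrable_mat P n n Q"
    unfolding integrable_mat_def
  proof (intro conjI ballI allI impI)
    fix i j assume ij: "i < n" "j < n"
    show "integrable P (\<lambda>w. Q w $$ (i, j))"
    proof (rule integrable_const_bound[of _ 1])
      show "AE w in P. norm (Q w $$ (i, j)) \<le> 1"
        using symmetric_idempotent_entry_bound[OF Q ij] by (auto intro!: AE_I2)
    qed (use Qm ij in \<open>simp add: measurable_mat_def\<close>)
  qed (use Q in auto)
  have ZQ: "Z w = R * (Q w * R)" if "w \<in> space P" for w
  proof -
    \<comment> \<open>Splitting the inverse of \<open>B\<close> as \<open>C * C\<close> makes the
      argument of \<open>pinv\<close> the product whose pseudoinverse occurs in
      \<open>range_proj\<close>. The outer factors of \<open>Z\<close> are then matched by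
      \<open>A = (A * C) * R\<close> and its transpose.\<close>
    have M: "transpose_mat (S w) * A * inv_mat B * transpose_mat A * S w = transpose_mat (Y w) * Y w"
      using S[OF that] unfolding YT[OF that] by (simp add: Y_def invB assoc_mult_mat_dim)
    have "transpose_mat (Y w) * Y w \<in> carrier_mat (q w) (q w)"
      using Y[OF that] by simp
    then have "pinv (transpose_mat (Y w) * Y w) \<in> carrier_mat (q w) (q w)"
      using pinv_symmetric(1)[of "transpose_mat (Y w) * Y w" "q w"] Y[OF that]
      by (auto simp: is_pinv_def transpose_mult_dim)
    moreover have "A = (A * C) * R" using A C(3) by (simp add: assoc_mult_mat_dim)
    ultimately show ?thesis
      using S[OF that] Y[OF that] C(3) A
      unfolding assms(6) M Q_def range_proj_def YT[OF that]
      by (simp add: Y_def assoc_mult_mat_dim RC)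
  qed
  define E where "E = expect_mat P n n Q"
  have E: "E \<in> carrier_mat n n" by (simp add: E_def)
  then have [simp]: "dim_row E = n" "dim_col E = n" by auto
  have ET: "transpose_mat E = E"
    unfolding E_def using Q by (subst expect_mat_transpose[symmetric]) (auto intro: expect_mat_cong)
  have QR: "expect_mat P n n (\<lambda>w. Q w * R) = E * R" "integrable_mat P n n (\<lambda>w. Q w * R)"
  proof -
    have T: "transpose_mat (R * Q w) = Q w * R" if "w \<in> space P" for w
      using Q[OF that] R by (simp add: transpose_mult[of _ n n _ n])
    note L = expect_mat_mult_left[OF R(1) Qi]
    have "expect_mat P n n (\<lambda>w. Q w * R) = expect_mat P n n (\<lambda>w. transpose_mat (R * Q w))"
      using T by (intro expect_mat_cong) simp
    also have "\<dots> = transpose_mat (R * E)"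
      using L(2) by (subst expect_mat_transpose) (auto simp: L(1) E_def integrable_mat_def)
    finally show "expect_mat P n n (\<lambda>w. Q w * R) = E * R"
      by (simp add: transpose_mult_dim ET R(2))
    show "integrable_mat P n n (\<lambda>w. Q w * R)"
      using integrable_mat_transpose[OF L(2)] T
      by (auto simp: integrable_mat_def cong: Bochner_Integration.integrable_cong)
  qed
  have EZ: "expect_mat P n n Z = R * (E * R)"
    using expect_mat_mult_left(1)[OF R(1) QR(2)] ZQ QR(1) expect_mat_cong[of P Z "\<lambda>w. R * (Q w * R)"] by simp
  have CEC: "C * expect_mat P n n Z * C = E"
    unfolding EZ using E C(2) by (simp add: assoc_mult_mat_dim CR)
  have BE: "inv_mat B * expect_mat P n n Z = C * E * R"
    unfolding EZ invB by (simp add: assoc_mult_mat_dim CR)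
  have BEc: "C * E * R \<in> carrier_mat n n" using C E R by simp
  \<comment> \<open>\<open>C\<close> and \<open>R\<close> are inverse to each other. The product
    \<open>C * E * R\<close> need not be symmetric, but \<open>lambda_min\<close> depends only on
    the set of eigenvalues, which similarity preserves.\<close>
  have "similar_mat (C * E * R) E"
    using similar_mat_witI[OF C(3,2) refl BEc E C(1) R(1)] by (auto simp: similar_mat_def)
  then have "eigenvalue (C * E * R) = eigenvalue E"
    by (intro ext) (simp add: eigenvalue_root_char_poly[OF BEc] eigenvalue_root_char_poly[OF E] char_poly_similar)
  then have \<rho>: "\<rho> = 1 - lambda_min E"
    unfolding assms(8) BE lambda_min_def by simp
  have "real (d w) = mat_trace (Q w)" if "w \<in> space P" for w
  proof -
    have "transpose_mat (S w) * A = transpose_mat (Y w) * R"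
      using S[OF that] A C(3) unfolding YT[OF that] by (simp add: assoc_mult_mat_dim)
    then show ?thesis
      unfolding assms(7) Q_def by (simp add: rank_eq_trace_range_proj[OF Y[OF that] R(1) C(1,2)])
  qed
  then have "(\<integral>w. real (d w) \<partial>P) = (\<integral>w. mat_trace (Q w) \<partial>P)"
    by (intro Bochner_Integration.integral_cong) auto
  also have "\<dots> = mat_trace E" by (simp add: E_def expect_mat_trace[OF Qi])
  finally have d: "(\<integral>w. real (d w) \<partial>P) = mat_trace E" .
  \<comment> \<open>The bound E[d] \<le> n is read off the diagonal of the mean projection, whose
    entries average numbers bounded by 1.\<close>
  have "E $$ (i, i) \<le> 1" if "i < n" for i
  proof -
    have "(\<integral>w. Q w $$ (i, i) \<partial>P) \<le> 1"
      using Qi that symmetric_idempotent_entry_bound[OF Q that that]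
      by (intro integral_le_const) (auto simp: integrable_mat_def abs_le_iff intro!: AE_I2)
    then show ?thesis using that by (simp add: E_def expect_mat_def)
  qed
  then have "mat_trace E \<le> (\<Sum>i<n. 1)" unfolding mat_trace_def \<open>dim_row E = n\<close> by (intro sum_mono) auto
  then have "mat_trace E \<le> real n" by simp
  have "0 \<le> lambda_min E"
  proof (rule lambda_min_nonneg[OF E ET n])
    fix v :: "real vec" assume v: "v \<in> carrier_vec n"
    have "0 \<le> v \<bullet> (Q w *\<^sub>v v)" if "w \<in> space P" for w
    proof -
      have Qv: "Q w *\<^sub>v v \<in> carrier_vec n" using Q(1)[OF that] v by simp
      have "Q w *\<^sub>v v = Q w *\<^sub>v (Q w *\<^sub>v v)"
        using assoc_mult_mat_vec[OF Q(1)[OF that] Q(1)[OF that] v] Q(3)[OF that] by simp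
      then have "v \<bullet> (Q w *\<^sub>v v) = (Q w *\<^sub>v v) \<bullet> (Q w *\<^sub>v v)"
        using symmetric_scalar_prod[OF Q(1,2)[OF that] v Qv] by simp
      then show ?thesis using scalar_prod_self_nonneg by simp
    qed
    then show "0 \<le> v \<bullet> (E *\<^sub>v v)"
      unfolding E_def expect_mat_quadratic_form[OF Qi v] by (intro integral_nonneg_AE AE_I2) auto
  qed
  moreover have "real n * lambda_min E \<le> mat_trace E"
    by (rule lambda_min_symmetric(2)[OF E ET n])
  \<comment> \<open>After division by the positive \<open>n\<close>, the trace bound gives the lower
    end of the chain, the comparison of \<open>n\<close> times the least eigenvalue with the trace
    gives the middle inequality, and nonnegativity of that eigenvalue gives
    \<open>\<rho> \<le> 1\<close>. The first conjunct follows from \<open>CEC\<close>.\<close>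
  ultimately show ?thesis
    using \<open>mat_trace E \<le> real n\<close> n
    unfolding d \<rho> R_def[symmetric] C_def[symmetric] CEC by (simp add: field_simps)
qed

end
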